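(* For a finite subgroup $G\subset SO(4)$ let $m_j(G)=\dim_{\mathbb{C}}\mathbb{C}[x_0,x_1,x_2,x_3]^G_j$ be the dimension of the space of $G$-invariant homogeneous polynomials of degree $j$. Then $(m_2,m_4,m_6,m_8,m_{10},m_{12})$ is as follows: \[ \begin{array}{l|l} VV & (1,5,6,15,19,35)\\ TV & (1,1,2,5,5,13)\\ TT & (1,1,2,3,3,7)\\ (TT)' & (1,3,4,7,9,15)\\ OV & (1,1,1,4,4,8)\\ OT & (1,1,1,2,2,4)\\ OO & (1,1,1,2,2,3)\\ (OO)' & (1,2,3,5,6,9)\\ (OO)'' & (1,1,2,3,3,5)\\ IV & (1,1,1,1,1,5)\\ IT & (1,1,1,1,1,3)\\ IO & (1,1,1,1,1,2)\\ II & (1,1,1,1,1,2)\\ VD_4 & (1,3,3,9,11,19)\\ VD_6 & (1,3,3,6,6,14)\\ VD_8 & (1,3,3,6,6,10)\\ TD_4 & (1,1,1,3,3,7)\\ TD_6 & (1,1,1,2,2,6)\\ TD_8 & (1,1,1,2,2,4)\\ OD_4 & (1,1,1,3,3,5)\\ OD_6 & (1,1,1,2,2,4)\\ OD_8 & (1,1,1,2,2,3)\\ ID_4 & (1,1,1,1,1,3)\\ ID_6 & (1,1,1,1,1,3)\\ ID_8 & (1,1,1,1,1,2) \end{array} \]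
   Context: Identify $\mathbb{R}^4$ with the quaternions via $(x_0,x_1,x_2,x_3)\leftrightarrow x_0+x_1 i+x_2 j+x_3 k$ and $SU(2)$ with the group of unit quaternions. A pair $(g_1,g_2)$ of unit quaternions acts on $\mathbb{R}^4$ by $p\mapsto g_1\,p\,g_2^{-1}$; this gives the double covering $SU(2)\times SU(2)\to SO(4)$. $SO(4)$ acts on $\mathbb{C}[x_0,x_1,x_2,x_3]$ by linear substitution. Put $\tau=\frac12(1+\sqrt5)$, $\tilde A_1=i$, $\tilde A_2=j$, $\tilde A_3=k$, $\tilde S=\frac12(1+i-j+k)$, $\tilde U=\frac12(\tau+(\tau-1)j+k)$, $\tilde R_n=\cos\frac{\pi}{n}+\sin\frac{\pi}{n}\,i$. Let $\tilde V=\langle \tilde A_1,\tilde A_2\rangle$ (order 8), $\tilde D_n=\langle\tilde A_2,\tilde R_n\rangle$ (order $4n$), $\tilde T=\langle\tilde A_1,\tilde S\rangle$ (binary tetrahedral, order 24), $\tilde O=\langle\tilde A_1,\tilde R_4,\tilde S\rangle$ (binary octahedral, order 48), $\tilde I=\langle \tilde A_1,\tilde S,\tilde U\rangle$ (binary icosahedral, order 120). For $G_1,G_2\in\{V,D_n,T,O,I\}$, $G_1G_2\subset SO(4)$ denotes the image of $\tilde G_1\times\tilde G_2$. The group $VV$ is the Heisenberg group (order 32). Moreover $(TT)'$ is the image of $\{(p,q)\in\tilde T\times\tilde T: p\tilde V=q\tilde V\}$, $(OO)'$ is the image of $\{(p,q)\in\tilde O\times\tilde O: p\tilde V=q\tilde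 V\}$, and $(OO)''$ is the image of $\{(p,q)\in\tilde O\times\tilde O: p\tilde T=q\tilde T\}$. *)

theory Defs
  imports
    "HOL-Analysis.Analysis"
    "HOL-Algebra.Generated_Groups"
    "HOL-Library.Poly_Mapping"
begin

text \<open>
  The type \<^typ>\<open>real^4\<close> is indexed by the numeral type 4, whose elements are
  0, 1, 2, 3 (and 4 = 0), so component \<open>$ i\<close> is the coordinate x_i. The library function
  \<^const>\<open>vector\<close> starts at index 1 and would put the last list entry into component 0;
  hence the separate constructor below.
\<close>

definition quat :: "real \<Rightarrow> real \<Rightarrow> real \<Rightarrow> real \<Rightarrow> real^4" where
  "quat a b c d = (\<chi> i. if i = 0 then a else if i = 1 then b else if i = 2 then c else d)"

definition quat_mult :: "real^4 \<Rightarrow> real^4 \<Rightarrow> real^4" where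
  "quat_mult p q = quat
     (p$0 * q$0 - p$1 * q$1 - p$2 * q$2 - p$3 * q$3)
     (p$0 * q$1 + p$1 * q$0 + p$2 * q$3 - p$3 * q$2)
     (p$0 * q$2 - p$1 * q$3 + p$2 * q$0 + p$3 * q$1)
     (p$0 * q$3 + p$1 * q$2 - p$2 * q$1 + p$3 * q$0)"

definition SU2 :: "(real^4) monoid" where
  "SU2 = \<lparr>carrier = {q. norm q = 1}, mult = quat_mult, one = quat 1 0 0 0\<rparr>"

definition SO4 :: "(real^4^4) monoid" where
  "SO4 = \<lparr>carrier = {A. rotation_matrix A}, mult = (**), one = mat 1\<rparr>"

definition rot :: "real^4 \<Rightarrow> real^4 \<Rightarrow> real^4^4" where
  "rot p q = matrix (\<lambda>x. quat_mult (quat_mult p x) (inv\<^bsub>SU2\<^esub> q))"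

definition golden :: real where
  "golden = (1 + sqrt 5) / 2"

definition qA1 :: "real^4" where "qA1 = quat 0 1 0 0"
definition qA2 :: "real^4" where "qA2 = quat 0 0 1 0"
definition qS :: "real^4" where "qS = quat (1/2) (1/2) (-1/2) (1/2)"
definition qU :: "real^4" where "qU = quat (golden/2) 0 ((golden - 1)/2) (1/2)"
definition qR :: "nat \<Rightarrow> real^4" where
  "qR n = quat (cos (pi / real n)) (sin (pi / real n)) 0 0"

definition binV :: "(real^4) set" where "binV = generate SU2 {qA1, qA2}"
definition binD :: "nat \<Rightarrow> (real^4) set" where "binD n = generate SU2 {qA2, qR n}"
definition binT :: "(real^4) set" where "binT = generate SU2 {qA1, qS}"
definition binO :: "(real^4) set" where "binO = generate SU2 {qA1, qR 4, qS}"
definition binI :: "(real^4) set" where "binI = generate SU2 {qA1, qS, qU}"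

definition prod_grp :: "(real^4) set \<Rightarrow> (real^4) set \<Rightarrow> (real^4^4) set" where
  "prod_grp G1 G2 = {rot p q |p q. p \<in> G1 \<and> q \<in> G2}"

text \<open>
  In the usual notation (TT)' is \<open>fiber_grp binT binV\<close>, (OO)' is \<open>fiber_grp binO binV\<close>
  and (OO)'' is \<open>fiber_grp binO binT\<close>.
\<close>

definition fiber_grp :: "(real^4) set \<Rightarrow> (real^4) set \<Rightarrow> (real^4^4) set" where
  "fiber_grp G N = {rot p q |p q. p \<in> G \<and> q \<in> G \<and> p <#\<^bsub>SU2\<^esub> N = q <#\<^bsub>SU2\<^esub> N}"

text \<open>
  C[x_0, x_1, x_2, x_3]: finitely supported maps from exponent vectors to coefficients,
  with the convolution product of \<open>Poly_Mapping\<close>.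
\<close>

type_synonym cpoly = "(4 \<Rightarrow>\<^sub>0 nat) \<Rightarrow>\<^sub>0 complex"

definition const_poly :: "complex \<Rightarrow> cpoly" where
  "const_poly c = Poly_Mapping.single 0 c"

definition var_poly :: "4 \<Rightarrow> cpoly" where
  "var_poly i = Poly_Mapping.single (Poly_Mapping.single i 1) 1"

definition scale_poly :: "complex \<Rightarrow> cpoly \<Rightarrow> cpoly" where
  "scale_poly c f = const_poly c * f"

definition homogeneous :: "nat \<Rightarrow> cpoly \<Rightarrow> bool" where
  "homogeneous d f \<longleftrightarrow>
     (\<forall>e \<in> Poly_Mapping.keys f. (\<Sum>i\<in>UNIV. Poly_Mapping.lookup e i) = d)"

text \<open>
  The substitution of row i of \<open>A x\<close> for \<open>x_i\<close>, i.e. f(x) becomes f(A x). As an action this is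
  the one of the inverse of A in the left-action convention; a group of matrices has the same
  invariants under both conventions.
\<close>

definition lin_subst :: "real^4^4 \<Rightarrow> cpoly \<Rightarrow> cpoly" where
  "lin_subst A f =
     (\<Sum>e \<in> Poly_Mapping.keys f. const_poly (Poly_Mapping.lookup f e) *
        (\<Prod>i\<in>UNIV. (\<Sum>j\<in>UNIV. const_poly (of_real (A $ i $ j)) * var_poly j)
                       ^ Poly_Mapping.lookup e i))"

definition invariants :: "(real^4^4) set \<Rightarrow> nat \<Rightarrow> cpoly set" where
  "invariants G d = {f. homogeneous d f \<and> (\<forall>A\<in>G. lin_subst A f = f)}"

definition inv_dim :: "(real^4^4) set \<Rightarrow> nat \<Rightarrow> nat" where
  "inv_dim G d = vector_space.dim scale_poly (invariants G d)"

definition inv_dims :: "(real^4^4) set \<Rightarrow> nat list" where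
  "inv_dims G = map (inv_dim G) [2, 4, 6, 8, 10, 12]"

lemma UNIV_4_zero: "(UNIV :: 4 set) = {0, 1, 2, 3}"
  using UNIV_4 by auto

lemma sum_4_zero: "(\<Sum>i\<in>UNIV. f (i::4)) = f 0 + f 1 + f 2 + (f 3 :: 'a::comm_monoid_add)"
  unfolding UNIV_4_zero by (simp add: add.assoc)

lemma quat_nth [simp]:
  "quat a b c d $ 0 = a" "quat a b c d $ 1 = b" "quat a b c d $ 2 = c" "quat a b c d $ 3 = d"
  by (simp_all add: quat_def)

lemma quat_eq_iff: "p = q \<longleftrightarrow> p$0 = q$0 \<and> p$1 = q$1 \<and> p$2 = q$2 \<and> p$3 = (q::real^4)$3"
proof -
  have "(\<forall>i::4. P i) \<longleftrightarrow> P 0 \<and> P 1 \<and> P 2 \<and> P 3" for P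
    using UNIV_4_zero by (metis UNIV_I insertE singletonD)
  then show ?thesis by (simp add: vec_eq_iff)
qed

lemma norm_quat_sq: "(norm q)\<^sup>2 = (q$0)\<^sup>2 + (q$1)\<^sup>2 + (q$2)\<^sup>2 + ((q::real^4)$3)\<^sup>2"
  unfolding power2_norm_eq_inner inner_vec_def sum_4_zero by (simp add: power2_eq_square)

lemma norm_quat_mult: "norm (quat_mult p q) = norm p * norm q"
proof -
  have "(norm (quat_mult p q))\<^sup>2 = (norm p * norm q)\<^sup>2"
    unfolding power_mult_distrib norm_quat_sq by (simp add: quat_mult_def) algebra
  then show ?thesis
    by (simp add: power2_eq_iff_nonneg)
qed

lemma quat_mult_assoc: "quat_mult (quat_mult p q) r = quat_mult p (quat_mult q r)"
  unfolding quat_eq_iff by (simp add: quat_mult_def algebra_simps)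

lemma quat_mult_one: "quat_mult (quat 1 0 0 0) q = q" "quat_mult q (quat 1 0 0 0) = q"
  unfolding quat_eq_iff by (simp_all add: quat_mult_def)

lemma quat_mult_conj:
  assumes "norm q = 1"
  shows "quat_mult (quat (q$0) (- q$1) (- q$2) (- q$3)) q = quat 1 0 0 0"
proof -
  have "(q$0)\<^sup>2 + (q$1)\<^sup>2 + (q$2)\<^sup>2 + (q$3)\<^sup>2 = 1"
    using assms norm_quat_sq[of q] by simp
  then show ?thesis
    unfolding quat_eq_iff by (simp add: quat_mult_def power2_eq_square algebra_simps)
qed

lemma norm_quat_conj: "norm (quat (q$0) (- q$1) (- q$2) (- q$3)) = norm (q :: real^4)"
proof -
  have "(norm (quat (q$0) (- q$1) (- q$2) (- q$3)))\<^sup>2 = (norm q)\<^sup>2"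
    unfolding norm_quat_sq by simp
  then show ?thesis
    by (simp add: power2_eq_iff_nonneg)
qed

lemma group_SU2: "group SU2"
proof (rule groupI)
  show "\<exists>y\<in>carrier SU2. y \<otimes>\<^bsub>SU2\<^esub> x = \<one>\<^bsub>SU2\<^esub>" if "x \<in> carrier SU2" for x
    using that quat_mult_conj[of x] norm_quat_conj[of x] by (auto simp: SU2_def)
  have "(norm (quat 1 0 0 0))\<^sup>2 = 1"
    unfolding norm_quat_sq by simp
  then show "\<one>\<^bsub>SU2\<^esub> \<in> carrier SU2"
    by (simp add: SU2_def power2_eq_1_iff)
      (metis norm_ge_zero not_one_le_zero neg_0_le_iff_le)
qed (auto simp: SU2_def norm_quat_mult quat_mult_assoc quat_mult_one)

lemma inv_SU2:
  assumes "norm q = 1"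
  shows "inv\<^bsub>SU2\<^esub> q = quat (q$0) (- q$1) (- q$2) (- q$3)"
  using assms quat_mult_conj[OF assms] norm_quat_conj[of q]
  by (intro group.inv_equality[OF group_SU2]) (auto simp: SU2_def)

lemma linear_quat_sandwich: "linear (\<lambda>x. quat_mult (quat_mult p x) q)"
  by (rule linearI; unfold quat_eq_iff; simp add: quat_mult_def algebra_simps)

lemma rot_apply: "rot p q *v x = quat_mult (quat_mult p x) (inv\<^bsub>SU2\<^esub> q)"
  unfolding rot_def using linear_quat_sandwich by (simp add: matrix_works)

lemma rot_mult:
  assumes "norm p = 1" "norm q = 1" "norm p' = 1" "norm q' = 1"
  shows "rot (quat_mult p p') (quat_mult q q') = rot p q ** rot p' q'"
proof -
  have "inv\<^bsub>SU2\<^esub> (quat_mult q q') = quat_mult (inv\<^bsub>SU2\<^esub> q') (inv\<^bsub>SU2\<^esub> q)"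
    using group.inv_mult_group[OF group_SU2, of q q'] assms by (simp add: SU2_def)
  then have "rot (quat_mult p p') (quat_mult q q') *v x = (rot p q ** rot p' q') *v x" for x
    by (simp add: rot_apply quat_mult_assoc flip: matrix_vector_mul_assoc)
  then show ?thesis by (simp add: matrix_eq)
qed

lemma quat_sqrt:
  assumes "norm q = 1"
  shows "\<exists>r. norm r = 1 \<and> quat_mult r r = q"
proof (cases "q$0 = -1")
  case True
  then have "(q$1)\<^sup>2 + (q$2)\<^sup>2 + (q$3)\<^sup>2 = 0"
    using assms norm_quat_sq[of q] by simp
  then have "q$1 = 0 \<and> q$2 = 0 \<and> q$3 = 0"
    by (smt (verit) zero_le_power2 zero_eq_power2)
  then have sq: "quat_mult (quat 0 1 0 0) (quat 0 1 0 0) = q"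
    using True unfolding quat_eq_iff by (simp add: quat_mult_def)
  have "(norm (quat 0 1 0 0))\<^sup>2 = 1"
    unfolding norm_quat_sq by simp
  then have "norm (quat 0 1 0 0) = 1"
    by (metis norm_ge_zero power2_eq_1_iff not_one_le_zero neg_0_le_iff_le)
  with sq show ?thesis by blast
next
  case False
  have n: "(q$0)\<^sup>2 + (q$1)\<^sup>2 + (q$2)\<^sup>2 + (q$3)\<^sup>2 = 1"
    using assms norm_quat_sq[of q] by simp
  have "(q$0)\<^sup>2 \<le> 1"
    using n by (smt (verit) zero_le_power2)
  then have "\<bar>q$0\<bar> \<le> 1"
    by (simp add: abs_square_le_1)
  with False have pos: "1 + q$0 > 0" by linarith
  define s where "s = sqrt (2 * (1 + q$0))"
  have s: "s\<^sup>2 = 2 * (1 + q$0)" "s > 0"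
    using pos by (simp_all add: s_def)
  define r where "r = quat (s/2) (q$1/s) (q$2/s) (q$3/s)"
  have "s/2 * (s/2) = (1 + q$0)/2"
    using s(1) by (simp add: power2_eq_square)
  moreover have "(q$1/s)\<^sup>2 + (q$2/s)\<^sup>2 + (q$3/s)\<^sup>2 = (1 - q$0)/2"
  proof -
    have "(q$1/s)\<^sup>2 + (q$2/s)\<^sup>2 + (q$3/s)\<^sup>2 = (1 - (q$0)\<^sup>2) / s\<^sup>2"
      using n by (simp add: power_divide flip: add_divide_distrib)
    also have "\<dots> = ((1 + q$0) * (1 - q$0)) / (2 * (1 + q$0))"
      unfolding s(1) by (simp add: power2_eq_square algebra_simps)
    also have "\<dots> = (1 - q$0)/2"
      using pos by (simp add: field_simps)
    finally show ?thesis .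
  qed
  ultimately have "s/2 * (s/2) - q$1/s * (q$1/s) - q$2/s * (q$2/s) - q$3/s * (q$3/s) = q$0"
    unfolding power2_eq_square by argo
  then have sq: "quat_mult r r = q"
    using s(2) unfolding quat_eq_iff r_def quat_mult_def quat_nth by simp
  then have "norm r = 1"
    using norm_quat_mult[of r r] assms
    by (metis norm_ge_zero power2_eq_square power2_eq_1_iff not_one_le_zero neg_0_le_iff_le)
  with sq show ?thesis by blast
qed

lemma rot_in_SO4:
  assumes "norm p = 1" "norm q = 1"
  shows "rotation_matrix (rot p q)"
proof -
  have orth: "orthogonal_matrix (rot p q)" if "norm p = 1" "norm q = 1" for p q
  proof -
    have "norm (inv\<^bsub>SU2\<^esub> q) = 1"
      using that inv_SU2[of q] norm_quat_conj[of q] by simp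
    then have "norm (rot p q *v x) = norm x" for x
      using that by (simp add: rot_apply norm_quat_mult)
    then have "orthogonal_transformation ((*v) (rot p q))"
      by (simp add: orthogonal_transformation)
    then show ?thesis
      by (simp add: orthogonal_transformation_matrix)
  qed
  obtain r s where rs: "norm r = 1" "quat_mult r r = p" "norm s = 1" "quat_mult s s = q"
    using quat_sqrt assms by metis
  then have "det (rot p q) = (det (rot r s))\<^sup>2"
    using rot_mult[of r s r s] by (simp add: det_mul power2_eq_square)
  moreover have "(det (rot r s))\<^sup>2 = 1"
    using det_orthogonal_matrix[OF orth[of r s]] rs by auto
  ultimately show ?thesis
    using orth[OF assms] by (simp add: rotation_matrix_def)
qed

lemma rot_hom: "(\<lambda>(p, q). rot p q) \<in> hom (SU2 \<times>\<times> SU2) SO4"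
  by (auto simp: hom_def DirProd_def SU2_def SO4_def rot_in_SO4 rot_mult)

lemma vector_space_poly: "vector_space scale_poly"
  by unfold_locales
    (simp_all add: scale_poly_def const_poly_def algebra_simps single_add mult_single
      flip: mult.assoc)

end

theory Submission
  imports Defs "HOL-Computational_Algebra.Formal_Power_Series"
begin

text \<open>
  The dimension of the invariants is the trace of the Reynolds operator, hence the average of the
  traces of the group elements. Up to conjugation a rotation given by unit quaternions p, q is
  complex diagonal with eigenvalues exp (i (a - b)), exp (i (b - a)), exp (i (a + b)),
  exp (- i (a + b)), where cos a and cos b are the real parts of p and q; so its trace on forms of
  degree d is the sum of chi l p * chi l q over l = d, d - 2, ..., with chi l the character of
  SU(2) in dimension l + 1. For a product group the average factors into averages over the two
  binary groups; for a fibre product over a normal subgroup N it is a sum of squares of character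
  sums over the cosets of N. All the binary groups contain the quaternion group V, and over a
  coset c V the character depends only on the squares of the coordinates of c, so a transversal of
  V is all that has to be known: powers of S for T, of R_n for D_n, and powers of R_4 or of U times
  powers of S for O and I.
\<close>

section \<open>Substitutions into polynomials\<close>

text \<open>The trace formula is the character identity behind the splitting of degree d forms into
  harmonic forms: with V_l the representation of SU(2) of dimension l + 1, the harmonic forms of
  degree l make up V_l \<otimes> V_l, and they enter degree d multiplied by a power of the invariant
  norm form. This is why every row of the table is a list of partial sums. The identity is verified
  on the diagonal torus alone, by generating functions, so neither harmonic polynomials nor
  representations are constructed. The groups inside SO(4) are never enumerated. Averages run over
  pairs of unit quaternions; the double covering only repeats each rotation, which leaves the
  projection onto the invariants unchanged. What remains is arithmetic in binary groups of order at
  most 120. Only even degrees occur, and there each chi is an even function; this is what makes the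
  sum over a coset of V depend on squares of coordinates only.\<close>

interpretation poly: vector_space scale_poly
  by (rule vector_space_poly)

lemma lookup_scale_poly [simp]:
  "Poly_Mapping.lookup (scale_poly c f) e = c * Poly_Mapping.lookup f e"
  by (simp add: scale_poly_def const_poly_def map.rep_eq when_def flip: mult_map_scale_conv_mult)

lemma const_poly_simps [simp]:
  "const_poly 0 = 0" "const_poly 1 = 1"
  "const_poly (a + b) = const_poly a + const_poly b"
  "const_poly (a * b) = const_poly a * const_poly b"
  by (simp_all add: const_poly_def single_add mult_single)

lemma const_poly_power: "const_poly (a ^ n) = const_poly a ^ n"
  by (induction n) simp_all

lemma const_poly_prod: "const_poly (prod a A) = (\<Prod>i\<in>A. const_poly (a i))"
  by (induction A rule: infinite_finite_induct) simp_all

lemma const_poly_sum: "const_poly (sum a A) = (\<Sum>i\<in>A. const_poly (a i))"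
  by (induction A rule: infinite_finite_induct) simp_all

lemma poly_sum_singles:
  assumes "finite K" "Poly_Mapping.keys f \<subseteq> K"
  shows "f = (\<Sum>e\<in>K. Poly_Mapping.single e (Poly_Mapping.lookup f e))"
proof (rule poly_mapping_eqI)
  fix e
  have "Poly_Mapping.lookup f e = (\<Sum>e'\<in>K. Poly_Mapping.lookup f e' when e' = e)"
    using assms by (auto simp: when_def in_keys_iff)
  then show "Poly_Mapping.lookup f e =
      Poly_Mapping.lookup (\<Sum>e\<in>K. Poly_Mapping.single e (Poly_Mapping.lookup f e)) e"
    by (simp add: lookup_sum lookup_single)
qed

text \<open>The evaluation homomorphism at \<open>\<phi>\<close>. Arbitrary images of the variables
  are allowed because diagonalising a rotation takes complex linear forms, while
  \<open>lin_subst\<close> takes real matrices.\<close>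

definition poly_subst :: "(4 \<Rightarrow> cpoly) \<Rightarrow> cpoly \<Rightarrow> cpoly" where
  "poly_subst \<phi> f =
     (\<Sum>e \<in> Poly_Mapping.keys f. const_poly (Poly_Mapping.lookup f e) *
        (\<Prod>i\<in>UNIV. \<phi> i ^ Poly_Mapping.lookup e i))"

text \<open>Terms may cancel in \<open>f + g\<close>; a common index set containing all supports
  makes additivity a termwise statement.\<close>

lemma poly_subst_superset:
  assumes "finite K" "Poly_Mapping.keys f \<subseteq> K"
  shows "poly_subst \<phi> f = (\<Sum>e\<in>K. const_poly (Poly_Mapping.lookup f e) *
        (\<Prod>i\<in>UNIV. \<phi> i ^ Poly_Mapping.lookup e i))"
  unfolding poly_subst_def using assms
  by (intro sum.mono_neutral_left) (auto simp: in_keys_iff)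

lemma poly_subst_single:
  "poly_subst \<phi> (Poly_Mapping.single e c) =
     const_poly c * (\<Prod>i\<in>UNIV. \<phi> i ^ Poly_Mapping.lookup e i)"
  by (subst poly_subst_superset[of "{e}"]) auto

lemma poly_subst_add: "poly_subst \<phi> (f + g) = poly_subst \<phi> f + poly_subst \<phi> g"
proof -
  let ?K = "Poly_Mapping.keys f \<union> Poly_Mapping.keys g"
  have "Poly_Mapping.keys (f + g) \<subseteq> ?K" by (rule keys_add)
  then show ?thesis
    by (simp add: poly_subst_superset[of ?K] lookup_add sum.distrib distrib_right)
qed

lemma poly_subst_0 [simp]: "poly_subst \<phi> 0 = 0"
  by (simp add: poly_subst_def)

lemma poly_subst_sum: "poly_subst \<phi> (sum f A) = (\<Sum>x\<in>A. poly_subst \<phi> (f x))"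
  by (induction A rule: infinite_finite_induct) (simp_all add: poly_subst_add)

lemma poly_subst_mult: "poly_subst \<phi> (f * g) = poly_subst \<phi> f * poly_subst \<phi> g"
proof -
  have single: "poly_subst \<phi> (Poly_Mapping.single e c * Poly_Mapping.single e' c') =
      poly_subst \<phi> (Poly_Mapping.single e c) * poly_subst \<phi> (Poly_Mapping.single e' c')" for e c e' c'
    by (simp add: mult_single poly_subst_single lookup_add power_add prod.distrib mult_ac)
  have f: "f = (\<Sum>e\<in>Poly_Mapping.keys f. Poly_Mapping.single e (Poly_Mapping.lookup f e))"
    and g: "g = (\<Sum>e\<in>Poly_Mapping.keys g. Poly_Mapping.single e (Poly_Mapping.lookup g e))"
    by (rule poly_sum_singles; simp)+
  show ?thesis
    by (subst (1 2) f, subst (1 2) g)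
      (simp add: sum_product poly_subst_sum single)
qed

lemma poly_subst_const [simp]: "poly_subst \<phi> (const_poly c) = const_poly c"
  by (simp add: const_poly_def poly_subst_single)

lemma poly_subst_1 [simp]: "poly_subst \<phi> 1 = 1"
  using poly_subst_const[of \<phi> 1] by simp

lemma poly_subst_power: "poly_subst \<phi> (f ^ n) = poly_subst \<phi> f ^ n"
  by (induction n) (simp_all add: poly_subst_mult)

lemma poly_subst_prod: "poly_subst \<phi> (prod f A) = (\<Prod>x\<in>A. poly_subst \<phi> (f x))"
  by (induction A rule: infinite_finite_induct) (simp_all add: poly_subst_mult)

lemma poly_subst_var [simp]: "poly_subst \<phi> (var_poly i) = \<phi> i"
proof -
  have "(\<Prod>j\<in>UNIV. \<phi> j ^ (1 when i = j)) = (\<Prod>j\<in>UNIV. if j = i then \<phi> j else 1)"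
    by (rule prod.cong) (auto simp: when_def)
  then show ?thesis
    by (simp add: var_poly_def poly_subst_single lookup_single)
qed

lemma poly_subst_poly_subst:
  "poly_subst \<psi> (poly_subst \<phi> f) = poly_subst (\<lambda>i. poly_subst \<psi> (\<phi> i)) f"
  by (simp add: poly_subst_def[of \<phi>] poly_subst_def[of "\<lambda>i. poly_subst \<psi> (\<phi> i)"]
      poly_subst_sum poly_subst_mult poly_subst_prod poly_subst_power)

lemma prod_var_poly:
  "(\<Prod>i\<in>UNIV. var_poly i ^ Poly_Mapping.lookup e i) = Poly_Mapping.single e 1"
proof -
  have pow: "var_poly i ^ n = Poly_Mapping.single (Poly_Mapping.single i n) 1" for i n
    by (induction n) (simp_all add: var_poly_def mult_single flip: single_add)
  have "(\<Prod>i\<in>A. Poly_Mapping.single (Poly_Mapping.single i (h i)) (1::complex))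
     = Poly_Mapping.single (\<Sum>i\<in>A. Poly_Mapping.single i (h i)) 1" for A :: "4 set" and h :: "4 \<Rightarrow> nat"
    by (induction A rule: infinite_finite_induct) (simp_all add: mult_single)
  moreover have "(\<Sum>i\<in>UNIV. Poly_Mapping.single i (Poly_Mapping.lookup e i)) = e"
    by (rule poly_mapping_eqI)
      (auto simp: lookup_sum lookup_single when_def)
  ultimately show ?thesis by (simp add: pow)
qed

lemma poly_subst_scale: "poly_subst \<phi> (scale_poly c f) = scale_poly c (poly_subst \<phi> f)"
  by (simp add: scale_poly_def poly_subst_mult)

lemma linear_poly_subst: "Vector_Spaces.linear scale_poly scale_poly (poly_subst \<phi>)"
  by unfold_locales (auto simp: poly_subst_add poly_subst_scale)

section \<open>Homogeneous polynomials\<close>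

lemma homogeneous_0 [simp]: "homogeneous d 0"
  by (simp add: homogeneous_def)

lemma homogeneous_add: "homogeneous d f \<Longrightarrow> homogeneous d g \<Longrightarrow> homogeneous d (f + g)"
  using keys_add[of f g] by (auto simp: homogeneous_def)

lemma homogeneous_sum: "(\<And>x. x \<in> A \<Longrightarrow> homogeneous d (f x)) \<Longrightarrow> homogeneous d (sum f A)"
  by (induction A rule: infinite_finite_induct) (simp_all add: homogeneous_add)

lemma homogeneous_mult: "homogeneous d f \<Longrightarrow> homogeneous d' g \<Longrightarrow> homogeneous (d + d') (f * g)"
  using keys_mult[of f g] by (fastforce simp: homogeneous_def lookup_add sum.distrib)

lemma homogeneous_const [simp]: "homogeneous 0 (const_poly c)"
  by (simp add: homogeneous_def const_poly_def)

lemma homogeneous_scale: "homogeneous d f \<Longrightarrow> homogeneous d (scale_poly c f)"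
  using homogeneous_mult[of 0 "const_poly c" d f] by (simp add: scale_poly_def)

lemma homogeneous_var: "homogeneous 1 (var_poly i)"
  by (simp add: homogeneous_def var_poly_def lookup_single when_def)

lemma homogeneous_1: "homogeneous 0 1"
  using homogeneous_const[of 1] by simp

lemma homogeneous_power: "homogeneous d f \<Longrightarrow> homogeneous (n * d) (f ^ n)"
  by (induction n) (auto simp: homogeneous_1 intro: homogeneous_mult)

lemma homogeneous_prod:
  "(\<And>x. x \<in> A \<Longrightarrow> homogeneous (h x) (f x)) \<Longrightarrow> homogeneous (sum h A) (prod f A)"
  by (induction A rule: infinite_finite_induct) (auto simp: homogeneous_1 intro: homogeneous_mult)

lemma homogeneous_poly_subst:
  assumes "homogeneous d f" "\<And>i. homogeneous 1 (\<phi> i)"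
  shows "homogeneous d (poly_subst \<phi> f)"
  unfolding poly_subst_def
proof (rule homogeneous_sum)
  fix e assume e: "e \<in> Poly_Mapping.keys f"
  have "homogeneous (Poly_Mapping.lookup e i) (\<phi> i ^ Poly_Mapping.lookup e i)" for i
    using homogeneous_power[OF assms(2)] by simp
  then have "homogeneous (\<Sum>i\<in>UNIV. Poly_Mapping.lookup e i)
      (\<Prod>i\<in>UNIV. \<phi> i ^ Poly_Mapping.lookup e i)"
    by (rule homogeneous_prod)
  from homogeneous_mult[OF homogeneous_const this]
  show "homogeneous d (const_poly (Poly_Mapping.lookup f e) *
        (\<Prod>i\<in>UNIV. \<phi> i ^ Poly_Mapping.lookup e i))"
    using e assms(1) by (simp add: homogeneous_def)
qed

definition monoms :: "nat \<Rightarrow> (4 \<Rightarrow>\<^sub>0 nat) set" where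
  "monoms d = {e. (\<Sum>i\<in>UNIV. Poly_Mapping.lookup e i) = d}"

definition expo :: "nat \<times> nat \<times> nat \<times> nat \<Rightarrow> (4 \<Rightarrow>\<^sub>0 nat)" where
  "expo = (\<lambda>(a, b, c, d). Poly_Mapping.single 0 a + Poly_Mapping.single 1 b
      + Poly_Mapping.single 2 c + Poly_Mapping.single 3 d)"

lemma lookup_expo [simp]:
  "Poly_Mapping.lookup (expo (a, b, c, d)) 0 = a" "Poly_Mapping.lookup (expo (a, b, c, d)) 1 = b"
  "Poly_Mapping.lookup (expo (a, b, c, d)) 2 = c" "Poly_Mapping.lookup (expo (a, b, c, d)) 3 = d"
  by (simp_all add: expo_def lookup_add lookup_single)

lemma bij_betw_expo:
  "bij_betw expo {(a, b, c, d). a + b + c + d = n} (monoms n)"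
proof (rule bij_betw_byWitness[where f' = "\<lambda>e. (Poly_Mapping.lookup e 0,
    Poly_Mapping.lookup e 1, Poly_Mapping.lookup e 2, Poly_Mapping.lookup e 3)"])
  have "expo (Poly_Mapping.lookup e 0, Poly_Mapping.lookup e 1,
      Poly_Mapping.lookup e 2, Poly_Mapping.lookup e 3) = e" for e
  proof (rule poly_mapping_eqI)
    fix i :: 4
    have "i \<in> {0, 1, 2, 3}" using UNIV_4_zero by blast
    then show "Poly_Mapping.lookup (expo (Poly_Mapping.lookup e 0, Poly_Mapping.lookup e 1,
      Poly_Mapping.lookup e 2, Poly_Mapping.lookup e 3)) i = Poly_Mapping.lookup e i" by auto
  qed
  then show "\<forall>e\<in>monoms n. expo (Poly_Mapping.lookup e 0, Poly_Mapping.lookup e 1,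
      Poly_Mapping.lookup e 2, Poly_Mapping.lookup e 3) = e" by blast
qed (auto simp: monoms_def sum_4_zero)

lemma finite_monoms: "finite (monoms d)"
proof -
  have "{(a, b, c, d'). a + b + c + d' = d} \<subseteq> {..d} \<times> {..d} \<times> {..d} \<times> {..d}" by auto
  then have "finite {(a, b, c, d'). a + b + c + d' = d}"
    by (rule finite_subset) auto
  then show ?thesis using bij_betw_finite[OF bij_betw_expo] by blast
qed

lemma homogeneous_iff_keys: "homogeneous d f \<longleftrightarrow> Poly_Mapping.keys f \<subseteq> monoms d"
  by (auto simp: homogeneous_def monoms_def)

lemma homogeneous_expand:
  assumes "homogeneous d f"
  shows "f = (\<Sum>e\<in>monoms d. scale_poly (Poly_Mapping.lookup f e) (Poly_Mapping.single e 1))"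
  using poly_sum_singles[OF finite_monoms[of d], of f] assms
  by (simp add: homogeneous_iff_keys scale_poly_def const_poly_def mult_single)

lemma homogeneous_single: "e \<in> monoms d \<Longrightarrow> homogeneous d (Poly_Mapping.single e 1)"
  by (simp add: homogeneous_iff_keys)

section \<open>Traces\<close>

text \<open>Reads only the degree d block of a map on all polynomials, which avoids a separate space
  of forms.\<close>

definition tr :: "nat \<Rightarrow> (cpoly \<Rightarrow> cpoly) \<Rightarrow> complex" where
  "tr d L = (\<Sum>e\<in>monoms d. Poly_Mapping.lookup (L (Poly_Mapping.single e 1)) e)"

lemma lookup_linear:
  assumes "Vector_Spaces.linear scale_poly scale_poly L" "homogeneous d f"
  shows "Poly_Mapping.lookup (L f) e =
    (\<Sum>e'\<in>monoms d. Poly_Mapping.lookup f e' * Poly_Mapping.lookup (L (Poly_Mapping.single e' 1)) e)"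
proof -
  interpret L: Vector_Spaces.linear scale_poly scale_poly L by fact
  show ?thesis
    by (subst homogeneous_expand[OF assms(2)]) (simp add: L.sum L.scale lookup_sum)
qed

text \<open>Since both maps preserve degree d, the intermediate index of the matrix product stays in
  the finite set \<open>monoms d\<close>, and the double sum can be swapped.\<close>

lemma tr_commute:
  assumes L: "Vector_Spaces.linear scale_poly scale_poly L" "\<And>f. homogeneous d f \<Longrightarrow> homogeneous d (L f)"
    and M: "Vector_Spaces.linear scale_poly scale_poly M" "\<And>f. homogeneous d f \<Longrightarrow> homogeneous d (M f)"
  shows "tr d (\<lambda>f. L (M f)) = tr d (\<lambda>f. M (L f))"
proof -
  let ?m = "\<lambda>L e' e. Poly_Mapping.lookup (L (Poly_Mapping.single e' 1)) e"
  have "tr d (\<lambda>f. L (M f)) = (\<Sum>e\<in>monoms d. \<Sum>e'\<in>monoms d. ?m M e e' * ?m L e' e)"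
    unfolding tr_def
    by (intro sum.cong lookup_linear[OF L(1)] M(2) homogeneous_single refl)
  also have "\<dots> = (\<Sum>e'\<in>monoms d. \<Sum>e\<in>monoms d. ?m L e' e * ?m M e e')"
    by (subst sum.swap) (simp add: mult.commute)
  also have "\<dots> = tr d (\<lambda>f. M (L f))"
    unfolding tr_def
    by (intro sum.cong lookup_linear[OF M(1), symmetric] L(2) homogeneous_single refl)
  finally show ?thesis .
qed

text \<open>
  With b ranging over a basis of W and P e = sum of c e b * b for a monomial e, the matrices of
  coefficients of the b and of the c e b have product 1 in one order and P in the other.
\<close>

lemma tr_projection:
  assumes P: "Vector_Spaces.linear scale_poly scale_poly P"
    and W: "poly.subspace W" "\<And>f. f \<in> W \<Longrightarrow> homogeneous d f"
    and PW: "\<And>f. homogeneous d f \<Longrightarrow> P f \<in> W" "\<And>f. f \<in> W \<Longrightarrow> P f = f"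
  shows "tr d P = of_nat (poly.dim W)"
proof -
  interpret P: Vector_Spaces.linear scale_poly scale_poly P by fact
  obtain B where B: "B \<subseteq> W" "poly.independent B" "W \<subseteq> poly.span B" "card B = poly.dim W"
    using poly.basis_exists by blast
  have "B \<subseteq> poly.span ((\<lambda>e. Poly_Mapping.single e 1) ` monoms d)"
  proof
    fix b assume "b \<in> B"
    then have "homogeneous d b" using B(1) W(2) by blast
    then show "b \<in> poly.span ((\<lambda>e. Poly_Mapping.single e 1) ` monoms d)"
      by (subst homogeneous_expand[OF \<open>homogeneous d b\<close>])
        (intro poly.span_sum poly.span_scale poly.span_base imageI)
  qed
  then have finB: "finite B"
    using poly.independent_span_bound[OF finite_imageI[OF finite_monoms] B(2)] by blast
  define c where "c e = poly.representation B (P (Poly_Mapping.single e 1))" for e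
  have c: "P (Poly_Mapping.single e 1) = (\<Sum>b\<in>B. scale_poly (c e b) b)" if "e \<in> monoms d" for e
  proof -
    have "P (Poly_Mapping.single e 1) \<in> poly.span B"
      using PW(1)[OF homogeneous_single[OF that]] B(3) by blast
    from poly.sum_representation_eq[OF B(2) this finB subset_refl] show ?thesis
      by (simp add: c_def)
  qed
  \<comment> \<open>Expand b in monomials, apply P, which fixes b, and compare coefficients in the
    basis B.\<close>
  have one: "(\<Sum>e\<in>monoms d. Poly_Mapping.lookup b e * c e b) = 1" if b: "b \<in> B" for b
  proof -
    have hb: "homogeneous d b" "P b = b" using B(1) W(2) PW(2) b by auto
    have "b = (\<Sum>e\<in>monoms d. scale_poly (Poly_Mapping.lookup b e) (P (Poly_Mapping.single e 1)))"
      by (subst hb(2)[symmetric], subst homogeneous_expand[OF hb(1)]) (simp add: P.sum P.scale)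
    also have "\<dots> = (\<Sum>e\<in>monoms d. \<Sum>b'\<in>B. scale_poly (Poly_Mapping.lookup b e * c e b') b')"
      by (simp add: c poly.scale_sum_right)
    also have "\<dots> = (\<Sum>b'\<in>B. scale_poly (\<Sum>e\<in>monoms d. Poly_Mapping.lookup b e * c e b') b')"
      by (subst sum.swap) (simp add: poly.scale_sum_left)
    finally have eq: "(\<Sum>b'\<in>B. scale_poly (\<Sum>e\<in>monoms d. Poly_Mapping.lookup b e * c e b') b') = b" ..
    have "(\<Sum>b'\<in>B. scale_poly ((\<Sum>e\<in>monoms d. Poly_Mapping.lookup b e * c e b')
        - (if b' = b then 1 else 0)) b') = 0"
      using b finB by (simp add: poly.scale_left_diff_distrib sum_subtractf eq
          if_distrib[of "\<lambda>x. scale_poly x _"] cong: if_cong)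
    then have "(\<Sum>e\<in>monoms d. Poly_Mapping.lookup b e * c e b) - (if b = b then 1 else 0) = 0"
      using poly.independentD[OF B(2) finB subset_refl] b by fast
    then show ?thesis by simp
  qed
  have "tr d P = (\<Sum>e\<in>monoms d. \<Sum>b\<in>B. Poly_Mapping.lookup b e * c e b)"
    unfolding tr_def by (simp add: c lookup_sum mult.commute)
  also have "\<dots> = (\<Sum>b\<in>B. 1)"
    by (subst sum.swap) (simp add: one)
  finally show ?thesis using B(4) by simp
qed

section \<open>The trace of a rotation\<close>

definition lin_form :: "complex^4^4 \<Rightarrow> 4 \<Rightarrow> cpoly" where
  "lin_form M i = (\<Sum>j\<in>UNIV. const_poly (M $ i $ j) * var_poly j)"

definition csubst :: "complex^4^4 \<Rightarrow> cpoly \<Rightarrow> cpoly" where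
  "csubst M = poly_subst (lin_form M)"

definition cplx :: "real^4^4 \<Rightarrow> complex^4^4" where
  "cplx A = (\<chi> i j. of_real (A $ i $ j))"

lemma lin_subst_eq: "lin_subst A = csubst (cplx A)"
  by (rule ext) (simp add: lin_subst_def csubst_def poly_subst_def lin_form_def cplx_def)

lemma cplx_mult: "cplx (A ** B) = cplx A ** cplx B"
  by (simp add: vec_eq_iff cplx_def matrix_matrix_mult_def)

lemma cplx_mat_1: "cplx (mat 1) = mat 1"
  by (simp add: vec_eq_iff cplx_def mat_def)

text \<open>Substitution reverses composition: replacing x by N x in f(M x) gives f(M N x).\<close>

lemma csubst_csubst: "csubst N (csubst M f) = csubst (M ** N) f"
proof -
  have "poly_subst (lin_form N) (lin_form M i) = lin_form (M ** N) i" for i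
    by (simp add: lin_form_def poly_subst_sum poly_subst_mult matrix_matrix_mult_def const_poly_sum
        sum_distrib_left sum_distrib_right mult.assoc) (rule sum.swap)
  then show ?thesis
    by (simp add: csubst_def poly_subst_poly_subst)
qed

lemma lin_subst_lin_subst: "lin_subst B (lin_subst A f) = lin_subst (A ** B) f"
  by (simp add: lin_subst_eq csubst_csubst cplx_mult)

lemma linear_csubst: "Vector_Spaces.linear scale_poly scale_poly (csubst M)"
  unfolding csubst_def by (rule linear_poly_subst)

lemma homogeneous_csubst: "homogeneous d f \<Longrightarrow> homogeneous d (csubst M f)"
  unfolding csubst_def
proof (rule homogeneous_poly_subst)
  show "homogeneous 1 (lin_form M i)" for i
    unfolding lin_form_def
    using homogeneous_mult[OF homogeneous_const homogeneous_var] by (intro homogeneous_sum) simp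
qed

definition diag :: "(4 \<Rightarrow> complex) \<Rightarrow> complex^4^4" where
  "diag l = (\<chi> i j. if i = j then l i else 0)"

text \<open>Cyclicity of the trace cancels S against its inverse. The intertwining form
  \<open>S ** M = D ** S\<close> can be checked entry by entry without an inverse matrix.\<close>

lemma tr_csubst_conj:
  assumes "S ** M = D ** S" "S' ** S = mat 1"
  shows "tr d (csubst M) = tr d (csubst D)"
proof -
  have "S ** S' = mat 1"
    using assms(2) by (simp add: matrix_left_right_inverse)
  have "M = S' ** (D ** S)"
    unfolding assms(1)[symmetric] by (simp add: matrix_mul_assoc assms(2))
  then have "tr d (csubst M) = tr d (\<lambda>f. csubst S (csubst D (csubst S' f)))"
    by (simp add: csubst_csubst matrix_mul_assoc)
  also have "\<dots> = tr d (\<lambda>f. csubst (S' ** D) (csubst S f))"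
    by (subst csubst_csubst) (rule tr_commute; simp add: linear_csubst homogeneous_csubst)
  also have "\<dots> = tr d (csubst D)"
    by (simp add: csubst_csubst matrix_mul_assoc \<open>S ** S' = mat 1\<close>)
  finally show ?thesis .
qed

lemma tr_csubst_diag:
  "tr d (csubst (diag l)) = (\<Sum>e\<in>monoms d. \<Prod>i\<in>UNIV. l i ^ Poly_Mapping.lookup e i)"
proof -
  have form: "lin_form (diag l) i = const_poly (l i) * var_poly i" for i
  proof -
    have "lin_form (diag l) i = (\<Sum>j\<in>UNIV. if j = i then const_poly (l i) * var_poly i else 0)"
      unfolding lin_form_def by (rule sum.cong) (auto simp: diag_def)
    then show ?thesis by simp
  qed
  have "csubst (diag l) (Poly_Mapping.single e 1) =
      scale_poly (\<Prod>i\<in>UNIV. l i ^ Poly_Mapping.lookup e i) (Poly_Mapping.single e 1)" for e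
    by (simp add: csubst_def poly_subst_single form power_mult_distrib prod.distrib prod_var_poly
        const_poly_prod const_poly_power scale_poly_def)
  then show ?thesis by (simp add: tr_def)
qed

section \<open>Characters of SU(2) and the sums over monomials\<close>

text \<open>
  chi n (2 cos t) = sin ((n + 1) t) / sin t is the character of the irreducible representation of
  SU(2) of dimension n + 1.
\<close>

fun chi :: "nat \<Rightarrow> 'a \<Rightarrow> 'a::comm_ring_1" where
  "chi 0 x = 1"
| "chi (Suc 0) x = x"
| "chi (Suc (Suc n)) x = x * chi (Suc n) x - chi n x"

lemma chi_of_real: "chi n (of_real x) = of_real (chi n x)"
  by (induction n x rule: chi.induct) simp_all

text \<open>The left side G m is the complete homogeneous symmetric polynomial of degree m. From G
  (m + 1) = x G m + y^(m + 1) and x y = 1 the leftover power of y is eliminated, leaving the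
  recursion of \<open>chi\<close> at x + y.\<close>

lemma sum_powers_eq_chi:
  fixes x y :: "'a::comm_ring_1"
  assumes "x * y = 1"
  shows "(\<Sum>j\<le>m. x ^ j * y ^ (m - j)) = chi m (x + y)"
proof -
  define G where "G m = (\<Sum>j\<le>m. x ^ j * y ^ (m - j))" for m
  have step: "G (Suc m) = x * G m + y ^ Suc m" for m
    unfolding G_def by (subst sum.atMost_Suc_shift) (simp add: sum_distrib_left mult.assoc)
  have "G m = chi m (x + y)"
  proof (induction m "x + y" rule: chi.induct)
    case 1 show ?case by (simp add: G_def)
  next
    case 2 show ?case by (simp add: G_def add.commute)
  next
    case (3 n)
    have "y * G (Suc n) = (x * y) * G n + y ^ Suc (Suc n)"
      by (simp add: step algebra_simps)
    then have "G (Suc (Suc n)) = (x + y) * G (Suc n) - G n"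
      by (simp add: step[of "Suc n"] assms algebra_simps)
    then show ?case using 3 by simp
  qed
  then show ?thesis by (simp add: G_def)
qed

text \<open>The degree is split between the pairs x_0, x_1 and x_2, x_3, because the diagonalised
  rotation has mutually inverse eigenvalues within each pair.\<close>

lemma sum_monoms:
  "(\<Sum>e\<in>monoms d. \<Prod>i\<in>UNIV. l i ^ Poly_Mapping.lookup e i) =
    (\<Sum>m\<le>d. (\<Sum>j\<le>m. l 0 ^ j * l 1 ^ (m - j)) * (\<Sum>k\<le>d - m. l 2 ^ k * l 3 ^ (d - m - k)))"
  for l :: "4 \<Rightarrow> 'a::comm_ring_1"
proof -
  have prod4: "(\<Prod>i\<in>UNIV. h i) = h 0 * h 1 * h 2 * h 3" for h :: "4 \<Rightarrow> 'a"
    unfolding UNIV_4_zero by (simp add: mult.assoc)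
  have "(\<Sum>e\<in>monoms d. \<Prod>i\<in>UNIV. l i ^ Poly_Mapping.lookup e i) =
      (\<Sum>(a, b, c, e) \<in> {(a, b, c, e). a + b + c + e = d}. l 0 ^ a * l 1 ^ b * l 2 ^ c * l 3 ^ e)"
    unfolding prod4
    by (subst sum.reindex_bij_betw[OF bij_betw_expo, symmetric]) (auto intro!: sum.cong)
  also have "\<dots> = (\<Sum>(m, j, k) \<in> (SIGMA m:{..d}. {..m} \<times> {..d - m}).
      (l 0 ^ j * l 1 ^ (m - j)) * (l 2 ^ k * l 3 ^ (d - m - k)))"
    by (rule sum.reindex_bij_witness[where i = "\<lambda>(m, j, k). (j, m - j, k, d - m - k)"
          and j = "\<lambda>(a, b, c, e). (a + b, a, c)"]) (auto simp: mult_ac)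
  also have "\<dots> = (\<Sum>m\<le>d. \<Sum>(j, k)\<in>{..m} \<times> {..d - m}.
      (l 0 ^ j * l 1 ^ (m - j)) * (l 2 ^ k * l 3 ^ (d - m - k)))"
    by (subst sum.Sigma[symmetric]) auto
  also have "\<dots> = (\<Sum>m\<le>d. (\<Sum>j\<le>m. l 0 ^ j * l 1 ^ (m - j)) * (\<Sum>k\<le>d - m. l 2 ^ k * l 3 ^ (d - m - k)))"
    by (simp add: sum_product sum.cartesian_product)
  finally show ?thesis .
qed

text \<open>The intended values are x = 2 cos (a - b), y = 2 cos (a + b), u = 2 cos a, v = 2 cos b.
  The left side is then the trace on all forms of degree d, the right side the sum of the traces on
  the harmonic pieces V_l \<otimes> V_l.\<close>

lemma chi_convolution:
  fixes u v x y :: "'a::idom"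
  assumes xy: "x + y = u * v" "x * y = u\<^sup>2 + v\<^sup>2 - 4"
  shows "(\<Sum>m\<le>d. chi m x * chi (d - m) y) =
    (\<Sum>k\<le>d div 2. chi (d - 2 * k) u * chi (d - 2 * k) v)"
proof -
  txt \<open>
    The generating function of \<^term>\<open>\<lambda>n. chi n z\<close> is 1 / A z, so the left-hand side has
    generating function 1 / (A x * A y), and the products chi n u * chi n v have generating function
    (1 - X^2) / (A x * A y); dividing by 1 - X^2 sums over steps of 2.
  \<close>
  define A :: "'a \<Rightarrow> 'a fps" where "A z = 1 - fps_const z * fps_X + fps_X ^ 2" for z
  define F :: "'a \<Rightarrow> 'a fps" where "F z = Abs_fps (\<lambda>n. chi n z)" for z
  define P where "P = Abs_fps (\<lambda>n. chi n u * chi n v)"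
  define G where "G = Abs_fps (\<lambda>n. \<Sum>k\<le>n div 2. chi (n - 2 * k) u * chi (n - 2 * k) v)"
  have FA: "F z * A z = 1" for z
  proof (rule fps_ext)
    fix n
    have "fps_nth (F z * A z) n = fps_nth (F z) n - z * fps_nth (F z * fps_X) n + fps_nth (F z * fps_X ^ 2) n"
      by (simp add: A_def algebra_simps)
    also have "\<dots> = fps_nth 1 n"
      by (cases "(n, z)" rule: chi.cases) (auto simp: F_def fps_X_power_mult_right_nth)
    finally show "fps_nth (F z * A z) n = fps_nth 1 n" .
  qed
  have AA: "A x * A y = 1 - fps_const (u * v) * fps_X + fps_const (u\<^sup>2 + v\<^sup>2 - 2) * fps_X ^ 2
      - fps_const (u * v) * fps_X ^ 3 + fps_X ^ 4" (is "_ = ?Q")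
  proof -
    have "A x * A y = 1 - (fps_const x + fps_const y) * fps_X
        + (fps_const x * fps_const y + 2) * fps_X ^ 2
        - (fps_const x + fps_const y) * fps_X ^ 3 + fps_X ^ 4"
      unfolding A_def by algebra
    moreover have "fps_const x + fps_const y = fps_const (u * v)"
      by (simp add: xy)
    moreover have "fps_const x * fps_const y + 2 = fps_const (u\<^sup>2 + v\<^sup>2 - 2)"
    proof -
      have "(2 :: 'a fps) = fps_const 2" by (simp add: numeral_fps_const)
      then have "fps_const x * fps_const y + 2 = fps_const (x * y + 2)" by simp
      also have "x * y + 2 = u\<^sup>2 + v\<^sup>2 - 2" by (simp add: xy)
      finally show ?thesis .
    qed
    ultimately show ?thesis by simp
  qed
  have PQ: "P * ?Q = 1 - fps_X ^ 2"
  proof (rule fps_ext)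
    fix n
    have split: "fps_nth (P * ?Q) n = fps_nth P n - (u * v) * fps_nth (P * fps_X) n + (u\<^sup>2 + v\<^sup>2 - 2) * fps_nth (P * fps_X ^ 2) n
        - (u * v) * fps_nth (P * fps_X ^ 3) n + fps_nth (P * fps_X ^ 4) n"
    proof -
      have "P * ?Q = P - fps_const (u * v) * (P * fps_X) + fps_const (u\<^sup>2 + v\<^sup>2 - 2) * (P * fps_X ^ 2)
        - fps_const (u * v) * (P * fps_X ^ 3) + P * fps_X ^ 4"
        by algebra
      then show ?thesis by (simp only: fps_sub_nth fps_add_nth fps_mult_left_const_nth)
    qed
    \<comment> \<open>\<open>?Q\<close> has degree 4, so the uniform recurrence starts at n = 4; the
      lower coefficients produce the numerator 1 - X^2.\<close>
    consider "n = 0" | "n = 1" | "n = 2" | "n = 3" | k where "n = Suc (Suc (Suc (Suc k)))"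
      by (metis One_nat_def numeral_2_eq_2 numeral_3_eq_3 not0_implies_Suc)
    then show "fps_nth (P * ?Q) n = fps_nth (1 - fps_X ^ 2) n"
    proof cases
      case 1 then show ?thesis unfolding split fps_X_power_mult_right_nth
        by (simp add: P_def)
    next
      case 2 then show ?thesis unfolding split fps_X_power_mult_right_nth
        by (simp add: P_def)
    next
      case 3 then show ?thesis unfolding split fps_X_power_mult_right_nth
        by (simp add: P_def numeral_2_eq_2 algebra_simps power2_eq_square)
    next
      case 4 then show ?thesis unfolding split fps_X_power_mult_right_nth
        by (simp add: P_def numeral_3_eq_3 numeral_2_eq_2 algebra_simps power2_eq_square)
    next
      case (5 k)
      \<comment> \<open>Products of two sequences with second-order recurrences satisfy a
        fourth-order one, whose characteristic roots are the products of the roots.\<close>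
      have "fps_nth P n - (u * v) * fps_nth P (n - 1) + (u\<^sup>2 + v\<^sup>2 - 2) * fps_nth P (n - 2)
        - (u * v) * fps_nth P (n - 3) + fps_nth P (n - 4) = 0"
        unfolding 5 P_def by (simp add: numeral_3_eq_3 numeral_2_eq_2) algebra
      then show ?thesis unfolding split fps_X_power_mult_right_nth using 5
        by simp
    qed
  qed
  have GP: "G * (1 - fps_X ^ 2) = P"
  proof (rule fps_ext)
    fix n
    have "fps_nth (G * (1 - fps_X ^ 2)) n = fps_nth G n - fps_nth (G * fps_X ^ 2) n"
      by (simp add: algebra_simps)
    also have "\<dots> = fps_nth P n"
    proof (cases "n < 2")
      case True
      then have "n div 2 = 0" by simp
      with True show ?thesis by (simp add: G_def P_def fps_X_power_mult_right_nth)
    next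
      case False
      then have "n div 2 = Suc ((n - 2) div 2)" by simp
      then have "fps_nth G n = fps_nth P n + fps_nth G (n - 2)"
        unfolding G_def P_def by (simp add: sum.atMost_Suc_shift del: sum.atMost_Suc)
      with False show ?thesis by (simp add: fps_X_power_mult_right_nth)
    qed
    finally show "fps_nth (G * (1 - fps_X ^ 2)) n = fps_nth P n" .
  qed
  have "(F x * F y) * (1 - fps_X ^ 2) = P * ((F x * A x) * (F y * A y))"
    unfolding PQ[symmetric] AA[symmetric] by (simp only: mult_ac)
  also have "\<dots> = G * (1 - fps_X ^ 2)"
    by (simp add: FA GP)
  finally have "(F x * F y - G) * (1 - fps_X ^ 2) = 0"
    by (simp add: algebra_simps)
  moreover have "(1 - fps_X ^ 2 :: 'a fps) \<noteq> 0"
  proof -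
    have "fps_nth (1 - fps_X ^ 2 :: 'a fps) 0 = 1" by simp
    then show ?thesis by (metis fps_zero_nth zero_neq_one)
  qed
  ultimately have "F x * F y = G" by simp
  then have "fps_nth (F x * F y) d = fps_nth G d" by simp
  then show ?thesis
    by (simp add: F_def G_def fps_mult_nth atMost_atLeast0)
qed

section \<open>Conjugation into the maximal torus and the trace of a rotation\<close>

definition qE :: "real \<Rightarrow> real^4" where
  "qE t = quat (cos t) (sin t) 0 0"

lemma norm_eq_1_quat: "norm (q :: real^4) = 1 \<longleftrightarrow> (q$0)\<^sup>2 + (q$1)\<^sup>2 + (q$2)\<^sup>2 + (q$3)\<^sup>2 = 1"
  using norm_quat_sq[of q] by (metis norm_ge_zero norm_zero power2_eq_1_iff abs_norm_cancel
      abs_1 power2_abs one_power2 abs_minus power2_eq_iff_nonneg zero_le_one)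

lemma norm_qE [simp]: "norm (qE t) = 1"
  by (simp add: norm_eq_1_quat qE_def)

lemma quat_conj_qE:
  assumes "norm p = 1"
  obtains r t where "norm r = 1" "quat_mult p r = quat_mult r (qE t)" "p $ 0 = cos t"
proof -
  define n where "n = sqrt ((p$1)\<^sup>2 + (p$2)\<^sup>2 + (p$3)\<^sup>2)"
  have n2: "n\<^sup>2 = (p$1)\<^sup>2 + (p$2)\<^sup>2 + (p$3)\<^sup>2" by (simp add: n_def)
  have "(p$0)\<^sup>2 + n\<^sup>2 = 1" using assms by (simp add: n2 norm_eq_1_quat)
  then obtain t where t: "p$0 = cos t" "n = sin t"
    using sincos_total_2pi by metis
  txt \<open>With v the vector part of p, v (v + n i) = (v + n i) n i because v v = - n n.\<close>
  define w where "w = quat 0 (p$1 + n) (p$2) (p$3)"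
  have pw: "quat_mult p w = quat_mult w (qE t)"
  proof -
    have "(sin t)\<^sup>2 = (p$1)\<^sup>2 + (p$2)\<^sup>2 + (p$3)\<^sup>2" using n2 t by simp
    then show ?thesis
      unfolding quat_eq_iff
      by (simp add: quat_mult_def w_def qE_def t power2_eq_square algebra_simps)
  qed
  show thesis
  proof (cases "w = 0")
    case False
    define r where "r = (1 / norm w) *\<^sub>R w"
    have "norm r = 1" using False by (simp add: r_def)
    moreover have "quat_mult p r = (1 / norm w) *\<^sub>R quat_mult p w"
      "quat_mult r (qE t) = (1 / norm w) *\<^sub>R quat_mult w (qE t)"
      unfolding quat_eq_iff r_def by (simp_all add: quat_mult_def algebra_simps)
    ultimately show ?thesis using that t pw by metis
  next
    \<comment> \<open>The vector part of p is then -n i, so p itself lies on the torus, at angle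
      -t.\<close>
    case True
    then have "p$1 = - n" "p$2 = 0" "p$3 = 0"
      unfolding quat_eq_iff by (simp_all add: w_def)
    then have "p = qE (- t)"
      using t unfolding quat_eq_iff by (simp add: qE_def)
    moreover have "norm (quat 1 0 0 0) = 1" by (simp add: norm_eq_1_quat)
    ultimately show ?thesis using that[of "quat 1 0 0 0" "- t"] t
      by (simp add: quat_mult_one)
  qed
qed

lemma all_4_zero: "(\<forall>i::4. P i) \<longleftrightarrow> P 0 \<and> P 1 \<and> P 2 \<and> P 3"
  using UNIV_4_zero by (metis UNIV_I insertE singletonD)

lemma tr_rot_qE:
  "tr d (csubst (cplx (rot (qE a) (qE b)))) =
    of_real (\<Sum>k\<le>d div 2. chi (d - 2 * k) (2 * cos a) * chi (d - 2 * k) (2 * cos b))"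
proof -
  define l :: "4 \<Rightarrow> complex" where
    "l i = (if i = 0 then cis (a - b) else if i = 1 then cis (b - a)
        else if i = 2 then cis (a + b) else cis (- a - b))" for i
  have l: "l 0 = cis (a - b)" "l 1 = cis (b - a)" "l 2 = cis (a + b)" "l 3 = cis (- a - b)"
    by (simp_all add: l_def)
  define row :: "complex \<Rightarrow> complex \<Rightarrow> complex \<Rightarrow> complex \<Rightarrow> complex^4" where
    "row a b c d = (\<chi> i. if i = 0 then a else if i = 1 then b else if i = 2 then c else d)" for a b c d
  have row: "row a b c d $ 0 = a" "row a b c d $ 1 = b" "row a b c d $ 2 = c" "row a b c d $ 3 = d" for a b c d
    by (simp_all add: row_def)
  \<comment> \<open>Write a quaternion as z + w j with z = x_0 + x_1 i and w = x_2 + x_3 i. The rows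
    of S read off z, its conjugate, w and its conjugate. Because j exp (-i b) = exp (i b) j, the
    rotation multiplies z by \<open>cis (a - b)\<close> and w by \<open>cis (a + b)\<close>.\<close>
  define S S' :: "complex^4^4" where
    "S = (\<chi> i. if i = 0 then row 1 \<i> 0 0 else if i = 1 then row 1 (- \<i>) 0 0
        else if i = 2 then row 0 0 1 \<i> else row 0 0 1 (- \<i>))"
    and "S' = (\<chi> i. if i = 0 then row (1/2) (1/2) 0 0 else if i = 1 then row (- \<i>/2) (\<i>/2) 0 0
        else if i = 2 then row 0 0 (1/2) (1/2) else row 0 0 (- \<i>/2) (\<i>/2))"
  have S: "S $ 0 = row 1 \<i> 0 0" "S $ 1 = row 1 (- \<i>) 0 0" "S $ 2 = row 0 0 1 \<i>" "S $ 3 = row 0 0 1 (- \<i>)"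
    "S' $ 0 = row (1/2) (1/2) 0 0" "S' $ 1 = row (- \<i>/2) (\<i>/2) 0 0"
    "S' $ 2 = row 0 0 (1/2) (1/2)" "S' $ 3 = row 0 0 (- \<i>/2) (\<i>/2)"
    by (simp_all add: S_def S'_def)
  have "S' ** S = mat 1"
    by (simp add: vec_eq_iff matrix_matrix_mult_def all_4_zero sum_4_zero S row mat_def)
  moreover have "S ** cplx (rot (qE a) (qE b)) = diag l ** S"
    by (simp add: vec_eq_iff matrix_matrix_mult_def all_4_zero sum_4_zero S row diag_def l
        cplx_def rot_def matrix_def axis_def inv_SU2 quat_mult_def)
      (simp add: qE_def complex_eq_iff cos_add cos_diff sin_add sin_diff algebra_simps)
  ultimately have "tr d (csubst (cplx (rot (qE a) (qE b)))) = tr d (csubst (diag l))"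
    by (rule tr_csubst_conj[rotated])
  also have "\<dots> = (\<Sum>m\<le>d. chi m (l 0 + l 1) * chi (d - m) (l 2 + l 3))"
    unfolding tr_csubst_diag sum_monoms
    by (subst (1 2) sum_powers_eq_chi) (simp_all add: l cis_mult)
  also have "\<dots> = (\<Sum>m\<le>d. chi m (of_real (2 * cos (a - b))) * chi (d - m) (of_real (2 * cos (a + b))))"
  proof -
    have "l 0 + l 1 = of_real (2 * cos (a - b))" "l 2 + l 3 = of_real (2 * cos (a + b))"
      by (simp_all add: l complex_eq_iff cos_diff sin_diff cos_add sin_add)
    then show ?thesis by simp
  qed
  also have "\<dots> = of_real (\<Sum>m\<le>d. chi m (2 * cos (a - b)) * chi (d - m) (2 * cos (a + b)))"
    by (simp flip: chi_of_real)
  also have "(\<Sum>m\<le>d. chi m (2 * cos (a - b)) * chi (d - m) (2 * cos (a + b))) =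
      (\<Sum>k\<le>d div 2. chi (d - 2 * k) (2 * cos a) * chi (d - 2 * k) (2 * cos b))"
  proof (rule chi_convolution)
    show "2 * cos (a - b) + 2 * cos (a + b) = 2 * cos a * (2 * cos b)"
      by (simp add: cos_diff cos_add)
    show "2 * cos (a - b) * (2 * cos (a + b)) = (2 * cos a)\<^sup>2 + (2 * cos b)\<^sup>2 - 4"
    proof -
      have "2 * cos (a - b) * (2 * cos (a + b)) = 4 * ((cos a)\<^sup>2 * (cos b)\<^sup>2 - (sin a)\<^sup>2 * (sin b)\<^sup>2)"
        by (simp add: cos_diff cos_add algebra_simps power2_eq_square)
      then show ?thesis
        unfolding sin_squared_eq by (simp add: algebra_simps)
    qed
  qed
  finally show ?thesis .
qed

text \<open>Moving p and q into the torus by r and s conjugates \<open>rot p q\<close> by the single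
  rotation \<open>rot r s\<close>, whose inverse is its transpose.\<close>

lemma tr_lin_subst_rot:
  assumes "norm p = 1" "norm q = 1"
  shows "tr d (lin_subst (rot p q)) =
    of_real (\<Sum>k\<le>d div 2. chi (d - 2 * k) (2 * p $ 0) * chi (d - 2 * k) (2 * q $ 0))"
proof -
  obtain r a where r: "norm r = 1" "quat_mult p r = quat_mult r (qE a)" "p $ 0 = cos a"
    using quat_conj_qE[OF assms(1)] .
  obtain s b where s: "norm s = 1" "quat_mult q s = quat_mult s (qE b)" "q $ 0 = cos b"
    using quat_conj_qE[OF assms(2)] .
  let ?R = "rot r s" and ?E = "rot (qE a) (qE b)"
  let ?R' = "transpose ?R"
  have RR: "?R' ** ?R = mat 1" "?R ** ?R' = mat 1"
    using rot_in_SO4[OF r(1) s(1)] by (auto simp: rotation_matrix_def orthogonal_matrix_def)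
  have "rot p q ** ?R = ?R ** ?E"
    using assms r s by (simp flip: rot_mult)
  then have "?R' ** (rot p q ** ?R) ** ?R' = ?R' ** (?R ** ?E) ** ?R'"
    by simp
  moreover have "?R' ** (rot p q ** ?R) ** ?R' = ?R' ** rot p q"
    by (simp add: RR flip: matrix_mul_assoc)
  moreover have "?R' ** (?R ** ?E) ** ?R' = ?E ** ?R'"
    by (simp add: RR matrix_mul_assoc)
  ultimately have "?R' ** rot p q = ?E ** ?R'"
    by simp
  then have "cplx ?R' ** cplx (rot p q) = cplx ?E ** cplx ?R'" "cplx ?R ** cplx ?R' = mat 1"
    using RR by (simp_all add: cplx_mat_1 flip: cplx_mult)
  then have "tr d (csubst (cplx (rot p q))) = tr d (csubst (cplx ?E))"
    by (rule tr_csubst_conj)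
  then show ?thesis
    by (simp add: lin_subst_eq tr_rot_qE r s)
qed

section \<open>Molien's formula for subgroups of SO(4)\<close>

notation quat_mult (infixl "\<odot>" 70)

interpretation SU2: group SU2
  by (rule group_SU2)

lemma SU2_simps [simp]:
  "carrier SU2 = {q. norm q = 1}" "mult SU2 = quat_mult" "one SU2 = quat 1 0 0 0"
  by (simp_all add: SU2_def)

lemma quat_right_cancel:
  "norm p = 1 \<Longrightarrow> norm q = 1 \<Longrightarrow> norm r = 1 \<Longrightarrow> p \<odot> r = q \<odot> r \<longleftrightarrow> p = q"
  using SU2.right_cancel[of r p q] by simp

lemma quat_left_cancel:
  "norm p = 1 \<Longrightarrow> norm q = 1 \<Longrightarrow> norm r = 1 \<Longrightarrow> r \<odot> p = r \<odot> q \<longleftrightarrow> p = q"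
  using SU2.Units_l_cancel[of r p q] SU2.Units_eq by simp

text \<open>H is a set of pairs, not of matrices: (p, q) and (-p, -q) give the same rotation, and
  the average over pairs is still the projection onto the invariants. So the kernel of the covering
  never has to be divided out.\<close>

lemma molien_rot:
  fixes H :: "((real^4) \<times> (real^4)) set"
  assumes fin: "finite H" "H \<noteq> {}"
    and norm: "\<And>p q. (p, q) \<in> H \<Longrightarrow> norm p = 1 \<and> norm q = 1"
    and mult: "\<And>p q p' q'. (p, q) \<in> H \<Longrightarrow> (p', q') \<in> H \<Longrightarrow> (p \<odot> p', q \<odot> q') \<in> H"
  shows "real (card H) * real (inv_dim ((\<lambda>(p, q). rot p q) ` H) d) =
    (\<Sum>(p, q)\<in>H. \<Sum>k\<le>d div 2. chi (d - 2 * k) (2 * p $ 0) * chi (d - 2 * k) (2 * q $ 0))"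
proof -
  define R where "R = (\<lambda>(p, q). rot p q)"
  define W where "W = invariants (R ` H) d"
  define c where "c = 1 / complex_of_nat (card H)"
  define P where "P f = scale_poly c (\<Sum>h\<in>H. lin_subst (R h) f)" for f
  have card: "card H \<noteq> 0" using fin by simp
  have lin_add: "lin_subst A (f + g) = lin_subst A f + lin_subst A g"
    and lin_scale: "lin_subst A (scale_poly x f) = scale_poly x (lin_subst A f)"
    and lin_sum: "lin_subst A (sum h K) = (\<Sum>x\<in>K. lin_subst A (h x))"
    for A f g x K and h :: "(real^4) \<times> (real^4) \<Rightarrow> cpoly"
    by (simp_all add: lin_subst_eq csubst_def poly_subst_add poly_subst_scale poly_subst_sum)
  have "lin_subst A 0 = 0" for A
    by (simp add: lin_subst_eq csubst_def)
  then have W: "poly.subspace W"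
    unfolding poly.subspace_def
    by (auto simp: W_def invariants_def homogeneous_add homogeneous_scale lin_add lin_scale)
  have hom: "homogeneous d f" if "f \<in> W" for f
    using that by (simp add: W_def invariants_def)
  have "Vector_Spaces.linear scale_poly scale_poly P"
    by unfold_locales
      (auto simp: P_def lin_add lin_scale sum.distrib poly.scale_right_distrib mult.commute
        simp flip: poly.scale_sum_right)
  moreover have "P f \<in> W" if f: "homogeneous d f" for f
  proof -
    have "lin_subst (R h0) (P f) = P f" if h0: "h0 \<in> H" for h0
    proof -
      obtain p0 q0 where h0_eq: "h0 = (p0, q0)" by force
      \<comment> \<open>Translation is on the right because substitution reverses composition. An
        injection of the finite set H into itself is a permutation, so closure under products
        already gives invariance of the average.\<close>
      define m where "m = (\<lambda>(p, q). (p \<odot> p0, q \<odot> q0))"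
      have n0: "norm p0 = 1" "norm q0 = 1" using norm h0 h0_eq by auto
      have "inj_on m H"
        using norm n0 by (auto simp: inj_on_def m_def quat_right_cancel)
      moreover have "m ` H \<subseteq> H"
        using mult h0 by (auto simp: m_def h0_eq)
      ultimately have bij: "bij_betw m H H"
        using fin(1) by (metis bij_betw_def endo_inj_surj)
      have "lin_subst (R h0) (P f) = scale_poly c (\<Sum>h\<in>H. lin_subst (R (m h)) f)"
        unfolding P_def lin_scale lin_sum
        using norm n0 by (auto intro!: sum.cong arg_cong[of _ _ "scale_poly c"]
            simp: lin_subst_lin_subst R_def m_def h0_eq rot_mult)
      also have "\<dots> = P f"
        unfolding P_def by (subst sum.reindex_bij_betw[OF bij]) simp
      finally show ?thesis .
    qed
    moreover have "homogeneous d (P f)"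
      unfolding P_def lin_subst_eq
      by (intro homogeneous_scale homogeneous_sum homogeneous_csubst f)
    ultimately show ?thesis by (auto simp: W_def invariants_def)
  qed
  moreover have "P f = f" if "f \<in> W" for f
  proof -
    have "P f = scale_poly c (\<Sum>h\<in>H. f)"
      unfolding P_def using that by (simp add: W_def invariants_def)
    also have "\<dots> = f"
      by (simp add: poly.sum_constant_scale c_def card del: sum_constant)
    finally show ?thesis .
  qed
  ultimately have "tr d P = of_nat (poly.dim W)"
    by (intro tr_projection W hom)
  moreover have "tr d P = c * (\<Sum>h\<in>H. tr d (lin_subst (R h)))"
    unfolding tr_def P_def
    by (simp add: lookup_sum sum_distrib_left) (rule sum.swap)
  moreover have "(\<Sum>h\<in>H. tr d (lin_subst (R h))) = of_real (\<Sum>(p, q)\<in>H.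
      \<Sum>k\<le>d div 2. chi (d - 2 * k) (2 * p $ 0) * chi (d - 2 * k) (2 * q $ 0))" (is "_ = of_real ?S")
    using norm by (auto intro!: sum.cong simp: R_def tr_lin_subst_rot simp del: of_real_mult)
  ultimately have "of_nat (poly.dim W) = c * complex_of_real ?S" by simp
  then have "complex_of_real (real (card H) * real (poly.dim W)) = complex_of_real ?S"
    using card by (simp add: c_def)
  then have "real (card H) * real (poly.dim W) = ?S"
    unfolding of_real_eq_iff .
  then show ?thesis
    by (simp add: inv_dim_def W_def R_def)
qed

definition char_sum :: "nat \<Rightarrow> (real^4) set \<Rightarrow> real" where
  "char_sum l A = (\<Sum>p\<in>A. chi l (2 * p $ 0))"

lemma inv_dim_prod_grp:
  assumes "subgroup G SU2" "finite G" "subgroup G' SU2" "finite G'"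
  shows "real (card G) * real (card G') * real (inv_dim (prod_grp G G') d) =
    (\<Sum>k\<le>d div 2. char_sum (d - 2 * k) G * char_sum (d - 2 * k) G')"
proof -
  interpret G: subgroup G SU2 by fact
  interpret G': subgroup G' SU2 by fact
  have "prod_grp G G' = (\<lambda>(p, q). rot p q) ` (G \<times> G')"
    by (auto simp: prod_grp_def image_iff)
  moreover have "real (card (G \<times> G')) * real (inv_dim ((\<lambda>(p, q). rot p q) ` (G \<times> G')) d) =
      (\<Sum>(p, q)\<in>G \<times> G'. \<Sum>k\<le>d div 2. chi (d - 2 * k) (2 * p $ 0) * chi (d - 2 * k) (2 * q $ 0))"
    using assms G.one_closed G'.one_closed G.m_closed G'.m_closed G.subset G'.subset
    by (intro molien_rot) auto
  moreover have "\<dots> = (\<Sum>k\<le>d div 2. char_sum (d - 2 * k) G * char_sum (d - 2 * k) G')"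
    by (simp add: char_sum_def sum_product sum.swap[of _ _ "{..d div 2}"] flip: sum.cartesian_product)
  ultimately show ?thesis by (simp add: card_cartesian_product)
qed

section \<open>Cosets and transversals\<close>

definition left_coset :: "real^4 \<Rightarrow> (real^4) set \<Rightarrow> (real^4) set" where
  "left_coset c N = quat_mult c ` N"

lemma l_coset_eq_left_coset: "c <#\<^bsub>SU2\<^esub> N = left_coset c N"
  by (auto simp: l_coset_def left_coset_def)

definition transversal :: "(real^4) set \<Rightarrow> (real^4) set \<Rightarrow> (real^4) set \<Rightarrow> bool" where
  "transversal C N G \<longleftrightarrow> finite C \<and> C \<subseteq> carrier SU2 \<and> G = (\<Union>c\<in>C. left_coset c N) \<and>
     pairwise (\<lambda>c c'. disjnt (left_coset c N) (left_coset c' N)) C"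

lemma inj_on_left_mult: "norm c = 1 \<Longrightarrow> N \<subseteq> carrier SU2 \<Longrightarrow> inj_on (quat_mult c) N"
  by (rule inj_onI) (simp add: quat_left_cancel subset_iff)

lemma sum_transversal:
  assumes "transversal C N G" "subgroup N SU2" "finite N"
  shows "(\<Sum>g\<in>G. f g) = (\<Sum>c\<in>C. \<Sum>g\<in>left_coset c N. f g)"
proof -
  have "\<forall>c\<in>C. finite (left_coset c N)" using assms by (simp add: left_coset_def)
  then show ?thesis
    using assms(1) unfolding transversal_def
    by (auto intro!: sum.UNION_disjoint simp: pairwise_def disjnt_def)
qed

lemma card_left_coset:
  "norm c = 1 \<Longrightarrow> subgroup N SU2 \<Longrightarrow> card (left_coset c N) = card N"
  unfolding left_coset_def using subgroup.subset by (blast intro: card_image inj_on_left_mult)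

lemma card_transversal:
  assumes "transversal C N G" "subgroup N SU2" "finite N"
  shows "card G = card C * card N"
proof -
  have "card G = (\<Sum>c\<in>C. \<Sum>g\<in>left_coset c N. 1)"
    using sum_transversal[OF assms, of "\<lambda>_. 1::nat"] by simp
  also have "\<dots> = card C * card N"
    using assms by (simp add: card_left_coset transversal_def subset_iff)
  finally show ?thesis .
qed

lemma left_coset_self: "subgroup N SU2 \<Longrightarrow> q \<in> left_coset q N"
  using subgroup.one_closed[of N SU2]
  by (auto simp: left_coset_def image_iff quat_mult_one intro!: bexI[of _ "quat 1 0 0 0"])

lemma left_coset_absorb:
  assumes "subgroup N SU2" "norm c = 1" "p \<in> left_coset c N"
  shows "left_coset p N = left_coset c N"
  using SU2.l_repr_independence[of p c N] assms by (simp add: l_coset_eq_left_coset)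

text \<open>The pairs are those with q in p N, so there are |G| |N| of them. For p in a fixed coset
  c N, the partner q runs over the same coset, and the two sums combine to a square.\<close>

lemma inv_dim_fiber_grp:
  assumes G: "subgroup G SU2" "finite G" and N: "subgroup N SU2" "N \<subseteq> G"
    and normal: "\<And>g n. g \<in> G \<Longrightarrow> n \<in> N \<Longrightarrow> \<exists>n'\<in>N. n \<odot> g = g \<odot> n'"
    and C: "transversal C N G"
  shows "real (card G) * real (card N) * real (inv_dim (fiber_grp G N) d) =
    (\<Sum>k\<le>d div 2. \<Sum>c\<in>C. (char_sum (d - 2 * k) (left_coset c N))\<^sup>2)"
proof -
  interpret G: subgroup G SU2 by fact
  interpret N: subgroup N SU2 by fact
  have finN: "finite N" using G(2) N(2) by (rule finite_subset[rotated])
  have nG: "norm g = 1" if "g \<in> G" for g using that G.subset by auto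
  note self = left_coset_self[OF N(1)]
  have coset_G: "left_coset p N \<subseteq> G" if "p \<in> G" for p
    using that N(2) G.m_closed by (auto simp: left_coset_def)
  define H where "H = (SIGMA p:G. left_coset p N)"
  have coset_eq: "left_coset p N = left_coset q N \<longleftrightarrow> q \<in> left_coset p N" if "p \<in> G" for p q
    using self left_coset_absorb[OF N(1) nG[OF that]] by metis
  have "p \<in> G \<and> q \<in> G \<and> left_coset p N = left_coset q N \<longleftrightarrow> (p, q) \<in> H" for p q
    unfolding H_def using coset_eq[of p q] coset_G[of p] by blast
  then have "fiber_grp G N = {rot p q |p q. (p, q) \<in> H}"
    by (simp add: fiber_grp_def l_coset_eq_left_coset)
  then have "fiber_grp G N = (\<lambda>(p, q). rot p q) ` H"
    by (force simp: image_iff)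
  moreover have "real (card H) * real (inv_dim ((\<lambda>(p, q). rot p q) ` H) d) =
      (\<Sum>(p, q)\<in>H. \<Sum>k\<le>d div 2. chi (d - 2 * k) (2 * p $ 0) * chi (d - 2 * k) (2 * q $ 0))"
  proof (rule molien_rot)
    show "finite H" using G(2) finN by (auto simp: H_def left_coset_def)
    show "H \<noteq> {}" using G.one_closed self by (force simp: H_def)
    show "norm p = 1 \<and> norm q = 1" if "(p, q) \<in> H" for p q
      using that coset_G nG by (auto simp: H_def)
    show "(p \<odot> p', q \<odot> q') \<in> H" if pq: "(p, q) \<in> H" "(p', q') \<in> H" for p q p' q'
    proof -
      obtain n n' where n: "p \<in> G" "n \<in> N" "q = p \<odot> n" "p' \<in> G" "n' \<in> N" "q' = p' \<odot> n'"
        using pq by (auto simp: H_def left_coset_def)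
      \<comment> \<open>Closure of H under products: normality moves n past p'.\<close>
      obtain n'' where "n'' \<in> N" "n \<odot> p' = p' \<odot> n''" using normal n by blast
      then have "q \<odot> q' = p \<odot> p' \<odot> (n'' \<odot> n')"
        using n by (metis quat_mult_assoc)
      moreover have "n'' \<odot> n' \<in> N" using N.m_closed[of n'' n'] n \<open>n'' \<in> N\<close> by simp
      ultimately show ?thesis
        using n G.m_closed[of p p'] by (auto simp: H_def left_coset_def)
    qed
  qed
  moreover have "card H = card G * card N"
    using G(2) finN nG N(1) by (simp add: H_def card_left_coset left_coset_def[of _ N])
      (simp add: card_left_coset flip: left_coset_def)
  moreover have "(\<Sum>(p, q)\<in>H. \<Sum>k\<le>d div 2. chi (d - 2 * k) (2 * p $ 0) * chi (d - 2 * k) (2 * q $ 0))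
      = (\<Sum>k\<le>d div 2. \<Sum>p\<in>G. chi (d - 2 * k) (2 * p $ 0) * char_sum (d - 2 * k) (left_coset p N))"
    unfolding H_def char_sum_def using G(2) finN
    by (subst sum.Sigma[symmetric]) (auto simp: left_coset_def sum_distrib_left
        sum.swap[of _ _ "{..d div 2}"] intro!: sum.cong)
  moreover have "(\<Sum>p\<in>G. chi l (2 * p $ 0) * char_sum l (left_coset p N)) =
      (\<Sum>c\<in>C. (char_sum l (left_coset c N))\<^sup>2)" for l
  proof -
    have "(\<Sum>p\<in>left_coset c N. chi l (2 * p $ 0) * char_sum l (left_coset p N)) =
        (char_sum l (left_coset c N))\<^sup>2" if "c \<in> C" for c
    proof -
      have "norm c = 1" using that C by (auto simp: transversal_def)
      then have "(\<Sum>p\<in>left_coset c N. chi l (2 * p $ 0) * char_sum l (left_coset p N)) =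
          (\<Sum>p\<in>left_coset c N. chi l (2 * p $ 0) * char_sum l (left_coset c N))"
        by (intro sum.cong refl) (simp add: left_coset_absorb[OF N(1)])
      then show ?thesis
        by (simp add: char_sum_def power2_eq_square sum_distrib_right)
    qed
    then show ?thesis
      by (simp add: sum_transversal[OF C N(1) finN])
  qed
  ultimately show ?thesis by simp
qed

text \<open>Left multiplication by a generator maps the union of the cosets into itself as soon as
  it does so for the representatives; with finiteness, the inverses of the generators preserve the
  union too. Starting from 1, it contains the whole generated group.\<close>

lemma generate_eq_cosets:
  assumes X: "X \<subseteq> carrier SU2" and N: "subgroup N SU2" "finite N" "N \<subseteq> generate SU2 X"
    and C: "finite C" "C \<subseteq> generate SU2 X" "quat 1 0 0 0 \<in> C"
    and step: "\<And>x c. x \<in> X \<Longrightarrow> c \<in> C \<Longrightarrow> \<exists>c'\<in>C. x \<odot> c \<in> left_coset c' N"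
  shows "generate SU2 X = (\<Union>c\<in>C. left_coset c N)"
proof
  let ?U = "\<Union>c\<in>C. left_coset c N"
  interpret N: subgroup N SU2 by fact
  interpret GX: subgroup "generate SU2 X" SU2
    using X by (rule SU2.generate_is_subgroup)
  show U: "?U \<subseteq> generate SU2 X"
    using N(3) C(2) GX.m_closed by (auto simp: left_coset_def)
  have nU: "norm u = 1" if "u \<in> ?U" for u using that U GX.subset by auto
  have finU: "finite ?U" using C(1) N(2) by (auto simp: left_coset_def)
  have X_step: "x \<odot> u \<in> ?U" if x: "x \<in> X" and u: "u \<in> ?U" for x u
  proof -
    obtain c n where c: "c \<in> C" "n \<in> N" "u = c \<odot> n" using u by (auto simp: left_coset_def)
    obtain c' n' where c': "c' \<in> C" "n' \<in> N" "x \<odot> c = c' \<odot> n'"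
      using step[OF x c(1)] by (auto simp: left_coset_def)
    have "x \<odot> u = c' \<odot> (n' \<odot> n)" using c c' by (metis quat_mult_assoc)
    moreover have "n' \<odot> n \<in> N" using N.m_closed[of n' n] c c' by simp
    ultimately show ?thesis using c'(1) by (auto simp: left_coset_def)
  qed
  have closed: "g \<odot> u \<in> ?U" if "g \<in> generate SU2 X" "u \<in> ?U" for g u
    using that
  proof (induction arbitrary: u rule: generate.induct)
    case one then show ?case by (simp add: quat_mult_one)
  next
    case (incl h) then show ?case using X_step by blast
  next
    case (inv h)
    have h: "norm h = 1" using inv X by auto
    \<comment> \<open>Injective on a finite set, hence onto, so every u in the union is h v with v
      in the union.\<close>
    have "inj_on (quat_mult h) ?U"
      using nU h by (auto simp: inj_on_def quat_left_cancel)
    then have "quat_mult h ` ?U = ?U"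
      using X_step inv(1) finU by (intro endo_inj_surj) auto
    then obtain v where v: "v \<in> ?U" "u = h \<odot> v" using inv(2) by blast
    have "inv\<^bsub>SU2\<^esub> h \<odot> (h \<odot> v) = v"
      using SU2.inv_solve_left[of v h "h \<odot> v"] h nU[OF v(1)] by (simp add: norm_quat_mult)
    then show ?case using v by simp
  next
    case (eng h1 h2) then show ?case by (simp add: quat_mult_assoc)
  qed
  have "quat 1 0 0 0 \<in> ?U"
    using C(3) left_coset_self[OF N(1)] by blast
  then show "generate SU2 X \<subseteq> ?U"
    using closed[of _ "quat 1 0 0 0"] by (auto simp: quat_mult_one)
qed

text \<open>Cosets that meet coincide, so disjointness reduces to no representative lying in the
  coset of another.\<close>

lemma transversal_generate:
  assumes X: "X \<subseteq> carrier SU2" and N: "subgroup N SU2" "finite N" "N \<subseteq> generate SU2 X"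
    and C: "finite C" "C \<subseteq> generate SU2 X" "quat 1 0 0 0 \<in> C"
    and step: "\<And>x c. x \<in> X \<Longrightarrow> c \<in> C \<Longrightarrow> \<exists>c'\<in>C. x \<odot> c \<in> left_coset c' N"
    and disj: "\<And>c c'. c \<in> C \<Longrightarrow> c' \<in> C \<Longrightarrow> c' \<in> left_coset c N \<Longrightarrow> c = c'"
  shows "transversal C N (generate SU2 X)" "finite (generate SU2 X)"
proof -
  have eq: "generate SU2 X = (\<Union>c\<in>C. left_coset c N)"
    by (rule generate_eq_cosets[OF X N C step])
  then show "finite (generate SU2 X)" using C(1) N(2) by (simp add: left_coset_def)
  have Cn: "norm c = 1" if "c \<in> C" for c
    using that C(2) SU2.generate_incl[OF X] by auto
  note self = left_coset_self[OF N(1)]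
  have "disjnt (left_coset c N) (left_coset c' N)" if "c \<in> C" "c' \<in> C" "c \<noteq> c'" for c c'
    unfolding disjnt_iff
  proof (intro allI notI)
    fix p assume "p \<in> left_coset c N \<and> p \<in> left_coset c' N"
    then have "left_coset c N = left_coset c' N"
      using that Cn left_coset_absorb[OF N(1)] by metis
    then show False using disj[OF that(1,2)] self[of c'] that(3) by blast
  qed
  then show "transversal C N (generate SU2 X)"
    using C(1) Cn eq by (auto simp: transversal_def pairwise_def)
qed

text \<open>The elements whose conjugate by g falls into the generated group are closed under
  products and inverses, so the generators decide.\<close>

lemma normalize_generate:
  assumes X: "X \<subseteq> carrier SU2" and g: "norm g = 1"
    and step: "\<And>x. x \<in> X \<Longrightarrow> \<exists>n'\<in>generate SU2 X. x \<odot> g = g \<odot> n'"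
    and "n \<in> generate SU2 X"
  shows "\<exists>n'\<in>generate SU2 X. n \<odot> g = g \<odot> n'"
proof -
  interpret GX: subgroup "generate SU2 X" SU2
    using X by (rule SU2.generate_is_subgroup)
  show ?thesis using \<open>n \<in> generate SU2 X\<close>
  proof (induction rule: generate.induct)
    case one
    then show ?case using GX.one_closed by (auto simp: quat_mult_one intro!: bexI[of _ "quat 1 0 0 0"])
  next
    case (incl h) then show ?case using step by blast
  next
    case (inv h)
    obtain n' where n': "n' \<in> generate SU2 X" "h \<odot> g = g \<odot> n'" using step inv by blast
    have n: "norm h = 1" "norm n' = 1" using inv X n' GX.subset by auto
    have inv_cancel: "inv\<^bsub>SU2\<^esub> a \<odot> (a \<odot> b) = b" "a \<odot> (inv\<^bsub>SU2\<^esub> a \<odot> b) = b"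
      if "norm a = 1" "norm b = 1" for a b
      using that SU2.inv_solve_left[of b a "a \<odot> b"] SU2.r_inv[of a]
      by (simp_all add: norm_quat_mult quat_mult_one flip: quat_mult_assoc)
    have "norm (inv\<^bsub>SU2\<^esub> n') = 1" using SU2.inv_closed[of n'] n by simp
    have "h \<odot> g \<odot> inv\<^bsub>SU2\<^esub> n' = g"
      using n n' g SU2.r_inv[of n'] by (simp add: quat_mult_assoc quat_mult_one)
    then have "inv\<^bsub>SU2\<^esub> h \<odot> g = g \<odot> inv\<^bsub>SU2\<^esub> n'"
      using inv_cancel(1)[of h "g \<odot> inv\<^bsub>SU2\<^esub> n'"] n g \<open>norm (inv\<^bsub>SU2\<^esub> n') = 1\<close>
      by (simp add: norm_quat_mult quat_mult_assoc)
    then show ?case using GX.m_inv_closed[OF n'(1)] by blast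
  next
    case (eng h1 h2)
    then obtain n1 n2 where n: "n1 \<in> generate SU2 X" "h1 \<odot> g = g \<odot> n1"
      "n2 \<in> generate SU2 X" "h2 \<odot> g = g \<odot> n2" by blast
    then have "h1 \<odot> h2 \<odot> g = g \<odot> (n1 \<odot> n2)" by (metis quat_mult_assoc)
    then show ?case using GX.m_closed[OF n(1,3)] by auto
  qed
qed

text \<open>For g = c m with m in N, conjugation by m preserves N, so only c matters: n c m = c n' m
  = c m (m^-1 n' m).\<close>

lemma normal_transversal:
  assumes N: "subgroup N SU2" and C: "transversal C N G"
    and normal: "\<And>c n. c \<in> C \<Longrightarrow> n \<in> N \<Longrightarrow> \<exists>n'\<in>N. n \<odot> c = c \<odot> n'"
    and gn: "g \<in> G" "n \<in> N"
  shows "\<exists>n'\<in>N. n \<odot> g = g \<odot> n'"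
proof -
  interpret N: subgroup N SU2 by fact
  obtain c m where c: "c \<in> C" "m \<in> N" "g = c \<odot> m"
    using gn(1) C by (auto simp: transversal_def left_coset_def)
  obtain n' where n': "n' \<in> N" "n \<odot> c = c \<odot> n'" using normal c(1) gn(2) by blast
  have norms: "norm c = 1" "norm m = 1" "norm n' = 1"
    using c n' C N.subset by (auto simp: transversal_def)
  let ?n = "inv\<^bsub>SU2\<^esub> m \<odot> n' \<odot> m"
  have "n \<odot> g = c \<odot> (n' \<odot> m)" using c n' by (metis quat_mult_assoc)
  also have "\<dots> = c \<odot> (m \<odot> inv\<^bsub>SU2\<^esub> m) \<odot> (n' \<odot> m)"
    using SU2.r_inv[of m] norms by (simp add: quat_mult_one)
  also have "\<dots> = g \<odot> ?n" by (simp add: c quat_mult_assoc)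
  finally have "n \<odot> g = g \<odot> ?n" .
  moreover have "?n \<in> N"
    using N.m_closed[OF N.m_closed[OF N.m_inv_closed[OF c(2)] n'(1)] c(2)] by simp
  ultimately show ?thesis by blast
qed

section \<open>Quaternion arithmetic\<close>

lemma quat_mult_quat:
  "quat a b c d \<odot> quat a' b' c' d' =
    quat (a * a' - b * b' - c * c' - d * d') (a * b' + b * a' + c * d' - d * c')
      (a * c' - b * d' + c * a' + d * b') (a * d' + b * c' - c * b' + d * a')"
  by (simp add: quat_mult_def)

lemma quat_eq: "quat a b c d = quat a' b' c' d' \<longleftrightarrow> a = a' \<and> b = b' \<and> c = c' \<and> d = d'"
  by (simp add: quat_eq_iff)

lemma norm_quat_1: "norm (quat a b c d) = 1 \<longleftrightarrow> a\<^sup>2 + b\<^sup>2 + c\<^sup>2 + d\<^sup>2 = 1"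
  by (simp add: norm_eq_1_quat)

lemma golden_mult: "golden * golden = golden + 1" "golden * (golden * x) = golden * x + x"
proof -
  show *: "golden * golden = golden + 1"
    by (simp add: golden_def field_simps)
  show "golden * (golden * x) = golden * x + x"
    by (simp add: * flip: mult.assoc) (simp add: algebra_simps)
qed

lemma golden_bounds: "1 < golden" "golden < 2"
proof -
  have "1 < sqrt 5" "sqrt 5 < 3" by (simp_all add: real_less_lsqrt)
  then show "1 < golden" "golden < 2" by (simp_all add: golden_def)
qed

text \<open>For p = c n the inner product of c and p is the real part of c^-1 p = n. Cosets are told
  apart by an inner product that is no real part of an element of N.\<close>

lemma inner_left_coset:
  assumes "norm c = 1" "p \<in> left_coset c N"
  shows "\<exists>n\<in>N. n $ 0 = c \<bullet> p"
proof -
  obtain n where n: "n \<in> N" "p = c \<odot> n" using assms(2) by (auto simp: left_coset_def)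
  have "(c $ 0)\<^sup>2 + (c $ 1)\<^sup>2 + (c $ 2)\<^sup>2 + (c $ 3)\<^sup>2 = 1"
    using assms(1) by (simp add: norm_eq_1_quat)
  moreover have "c \<bullet> p = ((c $ 0)\<^sup>2 + (c $ 1)\<^sup>2 + (c $ 2)\<^sup>2 + (c $ 3)\<^sup>2) * n $ 0"
    unfolding n(2) inner_vec_def sum_4_zero
    by (simp add: quat_mult_def power2_eq_square algebra_simps)
  ultimately have "n $ 0 = c \<bullet> p" by simp
  with n(1) show ?thesis by blast
qed

lemma inner_quat: "quat a b c d \<bullet> quat a' b' c' d' = a * a' + b * b' + c * c' + d * d'"
  by (simp add: inner_vec_def sum_4_zero)

section \<open>Characters at even degree\<close>

text \<open>chi (2 n) as a polynomial in y = x^2 - 2; thus y = 2 cos (2 t) for x = 2 cos t.\<close>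

fun chi_even :: "nat \<Rightarrow> 'a \<Rightarrow> 'a::comm_ring_1" where
  "chi_even 0 y = 1"
| "chi_even (Suc 0) y = y + 1"
| "chi_even (Suc (Suc n)) y = y * chi_even (Suc n) y - chi_even n y"

lemma chi_even: "chi (2 * n) x = chi_even n (x\<^sup>2 - 2)"
proof (induction n "x\<^sup>2 - 2" rule: chi_even.induct)
  case 1 show ?case by simp
next
  case 2 show ?case by (simp add: numeral_2_eq_2 power2_eq_square)
next
  case (3 n)
  have "chi (2 * Suc (Suc n)) x = (x\<^sup>2 - 2) * chi (2 * Suc n) x - chi (2 * n) x"
    by (simp add: power2_eq_square algebra_simps)
  then show ?case using 3 by (simp only: chi_even.simps)
qed

lemma char_sum_left_coset:
  assumes "norm c = 1" "N \<subseteq> carrier SU2"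
  shows "char_sum l (left_coset c N) = (\<Sum>n\<in>N. chi l (2 * (c \<odot> n) $ 0))"
  unfolding char_sum_def left_coset_def
  by (subst sum.reindex[OF inj_on_left_mult[OF assms]]) simp

lemma left_coset_left_coset: "left_coset c (left_coset d N) = left_coset (c \<odot> d) N"
  by (auto simp: left_coset_def image_image quat_mult_assoc)

lemma transversal_left_coset:
  assumes "transversal D K N" "subgroup K SU2" "finite K" "norm c = 1" "N \<subseteq> carrier SU2"
  shows "char_sum l (left_coset c N) = (\<Sum>d\<in>D. char_sum l (left_coset (c \<odot> d) K))"
proof -
  have norm: "norm d = 1" if "d \<in> D" for d using that assms(1) by (auto simp: transversal_def)
  have "char_sum l (left_coset c N) = (\<Sum>d\<in>D. \<Sum>n\<in>left_coset d K. chi l (2 * (c \<odot> n) $ 0))"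
    unfolding char_sum_left_coset[OF assms(4,5)] by (rule sum_transversal[OF assms(1-3)])
  also have "\<dots> = (\<Sum>d\<in>D. char_sum l (left_coset (c \<odot> d) K))"
  proof (rule sum.cong[OF refl])
    fix d assume d: "d \<in> D"
    have "left_coset d K \<subseteq> N" using d assms(1) by (auto simp: transversal_def)
    with assms(5) have "left_coset d K \<subseteq> carrier SU2" by blast
    then show "(\<Sum>n\<in>left_coset d K. chi l (2 * (c \<odot> n) $ 0)) = char_sum l (left_coset (c \<odot> d) K)"
      by (simp add: char_sum_left_coset[OF assms(4)] flip: left_coset_left_coset)
  qed
  finally show ?thesis .
qed

lemma char_sum_transversal:
  assumes "transversal C N G" "subgroup N SU2" "finite N"
  shows "char_sum l G = (\<Sum>c\<in>C. char_sum l (left_coset c N))"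
  unfolding char_sum_def by (rule sum_transversal[OF assms])

text \<open>Serves the chain V < T < O: the representatives of V in O are products of those of T in
  O and of V in T.\<close>

lemma transversal_trans:
  assumes C: "transversal C N G" and D: "transversal D K N"
    and K: "subgroup K SU2"
  shows "transversal ((\<lambda>(c, d). c \<odot> d) ` (C \<times> D)) K G"
proof -
  have norm: "norm c = 1" if "c \<in> C \<union> D" for c
    using that assms(1,2) by (auto simp: transversal_def)
  have N: "N = (\<Union>d\<in>D. left_coset d K)" and G: "G = (\<Union>c\<in>C. left_coset c N)"
    using C D by (auto simp: transversal_def)
  have "left_coset c N = (\<Union>d\<in>D. left_coset (c \<odot> d) K)" for c
    unfolding N by (simp add: left_coset_def image_UN image_image quat_mult_assoc)
  then have "G = (\<Union>x\<in>(\<lambda>(c, d). c \<odot> d) ` (C \<times> D). left_coset x K)"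
    using G by auto
  moreover have "disjnt (left_coset (c \<odot> d) K) (left_coset (c' \<odot> d') K)"
    if m: "c \<in> C" "d \<in> D" "c' \<in> C" "d' \<in> D" and ne: "c \<odot> d \<noteq> c' \<odot> d'" for c d c' d'
  proof (cases "c = c'")
    case True
    with ne have "d \<noteq> d'" by auto
    then have dj: "disjnt (left_coset d K) (left_coset d' K)"
      using D m by (auto simp: transversal_def pairwise_def)
    have sub: "left_coset x K \<subseteq> {q. norm q = 1}" if "x \<in> D" for x
      using that norm subgroup.subset[OF K] by (auto simp: left_coset_def norm_quat_mult)
    have "c \<odot> x \<noteq> c \<odot> y" if "x \<in> left_coset d K" "y \<in> left_coset d' K" for x y
    proof
      assume "c \<odot> x = c \<odot> y"
      then have "x = y" using sub m that norm quat_left_cancel[of x y c] by blast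
      then show False using dj that by (auto simp: disjnt_iff)
    qed
    then show ?thesis
      unfolding True[symmetric] left_coset_left_coset[symmetric] disjnt_iff
      by (auto simp: left_coset_def[of c])
  next
    case False
    then have "disjnt (left_coset c N) (left_coset c' N)"
      using C m by (auto simp: transversal_def pairwise_def)
    moreover have "left_coset (c \<odot> d) K \<subseteq> left_coset c N" "left_coset (c' \<odot> d') K \<subseteq> left_coset c' N"
      using m by (auto simp: N left_coset_def quat_mult_assoc)
    ultimately show ?thesis by (auto simp: disjnt_iff)
  qed
  ultimately show ?thesis
    using C D norm by (auto simp: transversal_def pairwise_def norm_quat_mult)
qed

section \<open>The quaternion group\<close>

lemma norm_gens: "norm qA1 = 1" "norm qA2 = 1" "norm qS = 1" "norm qU = 1"
proof -
  show "norm qU = 1"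
    by (simp add: qU_def norm_quat_1 power2_eq_square field_simps golden_mult)
qed (simp_all add: qA1_def qA2_def qS_def norm_quat_1 power_divide)

lemma subgroup_generate: "X \<subseteq> carrier SU2 \<Longrightarrow> subgroup (generate SU2 X) SU2"
  by (rule SU2.generate_is_subgroup)

lemma generate_mult:
  "p \<in> generate SU2 X \<Longrightarrow> q \<in> generate SU2 X \<Longrightarrow> p \<odot> q \<in> generate SU2 X"
  using generate.eng[of p SU2 X q] by simp

lemma generate_one: "quat 1 0 0 0 \<in> generate SU2 X"
  using generate.one[of SU2 X] by simp

lemma binV_eq:
  "binV = {quat 1 0 0 0, quat (-1) 0 0 0, quat 0 1 0 0, quat 0 (-1) 0 0,
     quat 0 0 1 0, quat 0 0 (-1) 0, quat 0 0 0 1, quat 0 0 0 (-1)}" (is "_ = ?V")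
proof -
  let ?G = "generate SU2 {qA1, qA2}"
  have i: "quat 0 1 0 0 \<in> ?G" and j: "quat 0 0 1 0 \<in> ?G"
    by (auto simp: qA1_def qA2_def intro: generate.incl)
  have k: "quat 0 0 0 1 \<in> ?G" and m: "quat (-1) 0 0 0 \<in> ?G"
    using generate_mult[OF i j] generate_mult[OF i i] by (simp_all add: quat_mult_quat)
  have V: "?V \<subseteq> ?G"
    using i j k m generate_one[of "{qA1, qA2}"] generate_mult[OF m i] generate_mult[OF m j] generate_mult[OF m k]
    by (simp add: quat_mult_quat)
  \<comment> \<open>For the trivial subgroup the coset criterion says that the explicit list is
    closed under left multiplication by the generators.\<close>
  have "?G = (\<Union>c\<in>?V. left_coset c {quat 1 0 0 0})"
  proof (rule generate_eq_cosets)
    show "subgroup {quat 1 0 0 0} SU2"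
      using SU2.triv_subgroup by simp
    show "\<exists>c'\<in>?V. x \<odot> c \<in> left_coset c' {quat 1 0 0 0}" if "x \<in> {qA1, qA2}" "c \<in> ?V" for x c
      using that by (auto simp: left_coset_def quat_mult_one qA1_def qA2_def quat_mult_quat)
  qed (use V norm_gens generate_one in auto)
  moreover have "(\<Union>c\<in>?V. left_coset c {quat 1 0 0 0}) = ?V"
    by (auto simp: left_coset_def quat_mult_one)
  ultimately show ?thesis by (simp only: binV_def)
qed

lemma subgroup_binV: "subgroup binV SU2"
  unfolding binV_def by (rule subgroup_generate) (simp add: norm_gens)

lemma finite_binV: "finite binV"
  by (simp add: binV_eq)

lemma card_binV: "card binV = 8"
  by (simp add: binV_eq quat_eq)

text \<open>
  The real parts of the elements of the coset c V are plus and minus the four coordinates of c.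
\<close>

definition coset_char :: "nat \<Rightarrow> real^4 \<Rightarrow> real" where
  "coset_char n c = 2 * (chi_even n (4 * (c $ 0)\<^sup>2 - 2) + chi_even n (4 * (c $ 1)\<^sup>2 - 2)
     + chi_even n (4 * (c $ 2)\<^sup>2 - 2) + chi_even n (4 * (c $ 3)\<^sup>2 - 2))"

lemma char_sum_left_coset_binV:
  assumes "norm c = 1"
  shows "char_sum (2 * n) (left_coset c binV) = coset_char n c"
proof -
  have "char_sum (2 * n) (left_coset c binV) = (\<Sum>q\<in>binV. chi (2 * n) (2 * (c \<odot> q) $ 0))"
    by (rule char_sum_left_coset[OF assms]) (rule subgroup.subset[OF subgroup_binV])
  also have "\<dots> = coset_char n c"
    unfolding binV_eq
    by (simp add: quat_eq chi_even coset_char_def quat_mult_def power_mult_distrib)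
  finally show ?thesis .
qed

text \<open>Through \<open>inner_left_coset\<close>, these values exclude that two chosen
  representatives share a coset of V.\<close>

lemma binV_re: "n \<in> binV \<Longrightarrow> n $ 0 \<in> {0, 1, -1}"
  by (auto simp: binV_eq)

section \<open>The binary tetrahedral group\<close>

text \<open>The square of S. As S^3 = -1 lies in V, the powers 1, S, S^2 represent V in T.\<close>

definition qS2 :: "real^4" where "qS2 = quat (-1/2) (1/2) (-1/2) (1/2)"

lemma qS_square: "qS \<odot> qS = qS2"
  by (simp add: qS_def qS2_def quat_mult_quat)

lemma left_coset_binV:
  "left_coset (quat a b c d) binV = {quat a b c d, quat (-a) (-b) (-c) (-d),
     quat (-b) a d (-c), quat b (-a) (-d) c, quat (-c) (-d) a b, quat c d (-a) (-b),
     quat (-d) c (-b) a, quat d (-c) b (-a)}"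
  by (simp add: left_coset_def binV_eq quat_mult_quat)

lemma binV_subset_generate:
  assumes "qA1 \<in> generate SU2 X" "qA2 \<in> generate SU2 X" "X \<subseteq> carrier SU2"
  shows "binV \<subseteq> generate SU2 X"
  unfolding binV_def using assms
  by (intro SU2.generate_subgroup_incl subgroup_generate) auto

lemma transversal_binT: "transversal {quat 1 0 0 0, qS, qS2} binV binT" "finite binT"
proof -
  let ?C = "{quat 1 0 0 0, qS, qS2}"
  let ?G = "generate SU2 {qA1, qS}"
  have X: "{qA1, qS} \<subseteq> carrier SU2" using norm_gens by simp
  have gens: "qA1 \<in> ?G" "qS \<in> ?G" by (auto intro: generate.incl)
  have S2: "qS2 \<in> ?G" using generate_mult[OF gens(2) gens(2)] by (simp add: qS_square)
  \<comment> \<open>Since S^2 = -S^-1, this is minus the conjugate of i by S; it brings j, and with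
    it V, into the group generated by i and S.\<close>
  have "qS2 \<odot> qA1 \<odot> qS = qA2"
    by (simp add: qS_def qS2_def qA1_def qA2_def quat_mult_quat)
  then have "qA2 \<in> ?G" using generate_mult[OF generate_mult[OF S2 gens(1)] gens(2)] by simp
  then have V: "binV \<subseteq> ?G" using gens X by (intro binV_subset_generate)
  have step: "\<exists>c'\<in>?C. x \<odot> c \<in> left_coset c' binV" if "x \<in> {qA1, qS}" "c \<in> ?C" for x c
    using that by (auto simp: qS_def qS2_def qA1_def left_coset_binV quat_mult_quat quat_eq)
  have disj: "c = c'" if "c \<in> ?C" "c' \<in> ?C" "c' \<in> left_coset c binV" for c c'
    using that by (auto simp: qS_def qS2_def left_coset_binV quat_eq)
  show "transversal ?C binV binT" "finite binT"
    unfolding binT_def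
    by (rule transversal_generate[OF X subgroup_binV finite_binV V _ _ _ step disj];
        use gens S2 generate_one in auto)+
qed

lemma subgroup_binT: "subgroup binT SU2"
  unfolding binT_def by (rule subgroup_generate) (simp add: norm_gens)

lemma binT_eq: "binT = binV \<union> left_coset qS binV \<union> left_coset qS2 binV"
proof -
  have "left_coset (quat 1 0 0 0) binV = binV"
    by (simp add: left_coset_def quat_mult_one)
  then show ?thesis
    using transversal_binT(1) by (auto simp: transversal_def)
qed

lemma binT_re: "n \<in> binT \<Longrightarrow> n $ 0 \<in> {0, 1/2, -1/2, 1, -1}"
  by (auto simp: binT_eq left_coset_binV qS_def qS2_def dest!: binV_re)

lemma half_quat_in_binT:
  assumes "{a, b, c, d} \<subseteq> {1/2, -1/2}"
  shows "quat a b c d \<in> binT"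
proof -
  have "a = 1/2 \<or> a = -1/2" "b = 1/2 \<or> b = -1/2" "c = 1/2 \<or> c = -1/2" "d = 1/2 \<or> d = -1/2"
    using assms by (simp_all only: insert_subset insert_iff empty_iff simp_thms)
  then show ?thesis
    by (elim disjE; hypsubst; simp add: binT_eq left_coset_binV qS_def qS2_def quat_eq)
qed

lemma card_binT: "card binT = 24"
proof -
  have "card {quat 1 0 0 0, qS, qS2} = 3"
    by (simp add: qS_def qS2_def quat_eq)
  then show ?thesis
    using card_transversal[OF transversal_binT(1) subgroup_binV finite_binV] by (simp add: card_binV)
qed

lemma qS_qS2_in_binT: "qS \<in> binT" "qS2 \<in> binT"
  using subgroup_binV left_coset_self by (auto simp: binT_eq)

lemma binT_subset_generate:
  assumes "qA1 \<in> generate SU2 X" "qS \<in> generate SU2 X" "X \<subseteq> carrier SU2"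
  shows "binT \<subseteq> generate SU2 X"
  unfolding binT_def using assms
  by (intro SU2.generate_subgroup_incl subgroup_generate) auto

lemma binV_subset_binT: "binV \<subseteq> binT"
  by (auto simp: binT_eq)

lemma in_left_coset: "n \<in> N \<Longrightarrow> x = c \<odot> n \<Longrightarrow> x \<in> left_coset c N"
  by (simp add: left_coset_def)

section \<open>The binary octahedral group\<close>

lemma qR4_eq: "qR 4 = quat (sqrt 2 / 2) (sqrt 2 / 2) 0 0"
  by (simp add: qR_def cos_45 sin_45)

lemma norm_qR: "norm (qR n) = 1"
  by (simp add: qR_def norm_quat_1)

lemma transversal_binO: "transversal {quat 1 0 0 0, qR 4} binT binO" "finite binO"
proof -
  let ?C = "{quat 1 0 0 0, qR 4}"
  let ?X = "{qA1, qR 4, qS}"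
  have X: "?X \<subseteq> carrier SU2" using norm_gens norm_qR by simp
  have C: "?C \<subseteq> generate SU2 ?X"
    using generate_one by (auto intro: generate.incl)
  have T: "binT \<subseteq> generate SU2 ?X"
    using X by (intro binT_subset_generate) (auto intro: generate.incl)
  have A1: "qA1 \<in> binT" by (auto simp: binT_def intro: generate.incl)
  have 1: "quat 1 0 0 0 \<in> ?C" by simp
  have step: "\<exists>c'\<in>?C. x \<odot> c \<in> left_coset c' binT" if "x \<in> ?X" "c \<in> ?C" for x c
  proof -
    have "qA1 \<odot> qR 4 \<in> left_coset (qR 4) binT"
      by (rule in_left_coset[OF A1]) (simp add: qR4_eq qA1_def quat_mult_quat)
    moreover have "qR 4 \<odot> qR 4 \<in> left_coset (quat 1 0 0 0) binT"
      by (rule in_left_coset[OF A1]) (simp add: qR4_eq qA1_def quat_mult_quat)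
    moreover have "qS \<odot> qR 4 \<in> left_coset (qR 4) binT"
    proof (rule in_left_coset)
      show "quat (1/2) (1/2) (1/2) (1/2) \<in> binT" by (rule half_quat_in_binT) simp
      show "qS \<odot> qR 4 = qR 4 \<odot> quat (1/2) (1/2) (1/2) (1/2)"
        by (simp add: qR4_eq qS_def quat_mult_quat quat_eq)
    qed
    moreover have "qA1 \<odot> quat 1 0 0 0 \<in> left_coset (quat 1 0 0 0) binT"
      "qS \<odot> quat 1 0 0 0 \<in> left_coset (quat 1 0 0 0) binT"
      using A1 qS_qS2_in_binT by (auto simp: left_coset_def quat_mult_one)
    moreover have "qR 4 \<odot> quat 1 0 0 0 \<in> left_coset (qR 4) binT"
      using left_coset_self[OF subgroup_binT] by (simp add: quat_mult_one)
    ultimately show ?thesis using that by auto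
  qed
  \<comment> \<open>The two representatives have inner product sqrt 2 / 2, which is not the real
    part of an element of T.\<close>
  have disj: "c = c'" if "c \<in> ?C" "c' \<in> ?C" "c' \<in> left_coset c binT" for c c'
  proof (rule ccontr)
    assume "c \<noteq> c'"
    then have "c \<bullet> c' = sqrt 2 / 2"
      using that by (auto simp: qR4_eq inner_quat)
    moreover have "norm c = 1" using that norm_qR by (auto simp: norm_quat_1)
    ultimately have "sqrt 2 / 2 \<in> {0, 1/2, -1/2, 1, -1 :: real}"
      using inner_left_coset[OF _ that(3)] binT_re by metis
    moreover have "1 < sqrt 2" "sqrt 2 < 2" by (simp_all add: real_less_lsqrt)
    ultimately show False by auto
  qed
  show "transversal ?C binT binO" "finite binO"
    unfolding binO_def
    by (rule transversal_generate[OF X subgroup_binT transversal_binT(2) T _ C 1 step disj];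
        simp)+
qed

lemma subgroup_binO: "subgroup binO SU2"
  unfolding binO_def by (rule subgroup_generate) (simp add: norm_gens norm_qR)

lemma card_binO: "card binO = 48"
proof -
  have "card {quat 1 0 0 0, qR 4} = 2"
    by (simp add: qR4_eq quat_eq)
  then show ?thesis
    using card_transversal[OF transversal_binO(1) subgroup_binT transversal_binT(2)] by (simp add: card_binT)
qed

section \<open>The binary icosahedral group\<close>

text \<open>The powers of U in coordinates. U^5 = -1 lies in T, so the indices 0 to 4 suffice;
  larger indices all default to U^4.\<close>

definition qUpow :: "nat \<Rightarrow> real^4" where
  "qUpow k = (if k = 0 then quat 1 0 0 0
     else if k = 1 then quat (golden/2) 0 ((golden - 1)/2) (1/2)
     else if k = 2 then quat ((golden - 1)/2) 0 (1/2) (golden/2)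
     else if k = 3 then quat ((1 - golden)/2) 0 (1/2) (golden/2)
     else quat (- golden/2) 0 ((golden - 1)/2) (1/2))"

lemma qUpow:
  "qUpow 0 = quat 1 0 0 0" "qUpow (Suc 0) = quat (golden/2) 0 ((golden - 1)/2) (1/2)"
  "qUpow 2 = quat ((golden - 1)/2) 0 (1/2) (golden/2)"
  "qUpow 3 = quat ((1 - golden)/2) 0 (1/2) (golden/2)"
  "qUpow 4 = quat (- golden/2) 0 ((golden - 1)/2) (1/2)"
  by (simp_all add: qUpow_def)

lemma less_5_cases: "(k::nat) < 5 \<longleftrightarrow> k \<in> {0, 1, 2, 3, 4}"
  by auto

lemma qU_step: "k < 4 \<Longrightarrow> qU \<odot> qUpow k = qUpow (Suc k)" "qU \<odot> qUpow 4 = quat (-1) 0 0 0"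
proof -
  have "qU \<odot> qUpow 0 = qUpow 1" "qU \<odot> qUpow 1 = qUpow 2" "qU \<odot> qUpow 2 = qUpow 3"
    "qU \<odot> qUpow 3 = qUpow 4"
    by (simp_all add: qUpow qU_def quat_mult_quat quat_eq field_simps golden_mult)
  moreover assume "k < 4"
  then have "k \<in> {0, 1, 2, 3}" by auto
  ultimately show "qU \<odot> qUpow k = qUpow (Suc k)"
    by (auto simp: numeral_eq_Suc)
next
  show "qU \<odot> qUpow 4 = quat (-1) 0 0 0"
    by (simp add: qUpow qU_def quat_mult_quat quat_eq field_simps golden_mult)
qed

lemma norm_qUpow: "norm (qUpow k) = 1"
  by (auto simp: qUpow_def norm_quat_1 power2_eq_square field_simps golden_mult)

text \<open>The vector part of U is orthogonal to i, so i inverts U by conjugation: i U^k = U^-k i =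
  U^(5 - k) (-i) for k > 0.\<close>

lemma qA1_qUpow:
  "qA1 \<odot> qUpow 0 = qUpow 0 \<odot> quat 0 1 0 0" "qA1 \<odot> qUpow 1 = qUpow 4 \<odot> quat 0 (-1) 0 0"
  "qA1 \<odot> qUpow 2 = qUpow 3 \<odot> quat 0 (-1) 0 0" "qA1 \<odot> qUpow 3 = qUpow 2 \<odot> quat 0 (-1) 0 0"
  "qA1 \<odot> qUpow 4 = qUpow 1 \<odot> quat 0 (-1) 0 0"
  by (simp_all add: qA1_def qUpow quat_mult_quat quat_eq field_simps)

text \<open>On the five cosets U^k T, S acts as a 3-cycle of the indices 2, 3, 4, as an element of
  order three in A_5 must. The right factors are the elements of T left over.\<close>

lemma qS_qUpow:
  "qS \<odot> qUpow 0 = qUpow 0 \<odot> quat (1/2) (1/2) (-1/2) (1/2)"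
  "qS \<odot> qUpow 1 = qUpow 1 \<odot> quat (1/2) (-1/2) (-1/2) (1/2)"
  "qS \<odot> qUpow 2 = qUpow 3 \<odot> quat (1/2) (-1/2) (1/2) (-1/2)"
  "qS \<odot> qUpow 3 = qUpow 4 \<odot> quat (1/2) (1/2) (1/2) (-1/2)"
  "qS \<odot> qUpow 4 = qUpow 2 \<odot> quat 0 0 1 0"
  by (simp_all add: qS_def qUpow quat_mult_quat quat_eq field_simps)

lemma inj_qUpow: "inj_on qUpow {..<5}"
  using golden_bounds by (auto simp: inj_on_def less_5_cases qUpow quat_eq)

lemma transversal_binI: "transversal (qUpow ` {..<5}) binT binI" "finite binI"
proof -
  let ?C = "qUpow ` {..<5}"
  let ?X = "{qA1, qS, qU}"
  have X: "?X \<subseteq> carrier SU2" using norm_gens by simp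
  have U: "qU \<in> generate SU2 ?X" by (auto intro: generate.incl)
  have "qUpow k \<in> generate SU2 ?X" if "k < 5" for k
    using that
  proof (induction k)
    case 0 show ?case using generate_one by (simp add: qUpow)
  next
    case (Suc k)
    then show ?case using generate_mult[OF U, of "qUpow k"] by (simp add: qU_step(1))
  qed
  then have C: "?C \<subseteq> generate SU2 ?X" by auto
  have 1: "quat 1 0 0 0 \<in> ?C" by (auto simp: qUpow(1)[symmetric])
  have T: "binT \<subseteq> generate SU2 ?X"
    using X by (intro binT_subset_generate) (auto intro: generate.incl)
  have V: "binV \<subseteq> binT" by (rule binV_subset_binT)
  have step: "\<exists>c'\<in>?C. x \<odot> c \<in> left_coset c' binT" if x: "x \<in> ?X" and c: "c \<in> ?C" for x c
  proof -
    have *: "\<exists>c'\<in>?C. y \<in> left_coset c' binT" if "k < 5" "y = qUpow k \<odot> n" "n \<in> binT" for y k n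
      using that by (auto intro!: bexI[of _ "qUpow k"] simp: left_coset_def)
    have units: "quat 0 1 0 0 \<in> binT" "quat 0 (-1) 0 0 \<in> binT" "quat 0 0 1 0 \<in> binT"
      "quat (-1) 0 0 0 \<in> binT" "quat 1 0 0 0 \<in> binT"
      using V by (auto simp: binV_eq)
    have halves: "quat (1/2) (1/2) (-1/2) (1/2) \<in> binT" "quat (1/2) (-1/2) (-1/2) (1/2) \<in> binT"
      "quat (1/2) (-1/2) (1/2) (-1/2) \<in> binT" "quat (1/2) (1/2) (1/2) (-1/2) \<in> binT"
      by (auto intro: half_quat_in_binT)
    obtain k where k: "k < 5" "c = qUpow k" using c by auto
    consider "x = qA1" | "x = qS" | "x = qU" using x by auto
    then show ?thesis
    proof cases
      case 1
      show ?thesis using k(1) unfolding 1 k(2) less_5_cases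
        by (auto intro: *[OF _ qA1_qUpow(1) units(1)] *[OF _ qA1_qUpow(2) units(2)]
            *[OF _ qA1_qUpow(3) units(2)] *[OF _ qA1_qUpow(4) units(2)] *[OF _ qA1_qUpow(5) units(2)]
            simp del: One_nat_def bex_simps)
    next
      case 2
      show ?thesis using k(1) unfolding 2 k(2) less_5_cases
        by (auto intro: *[OF _ qS_qUpow(1) halves(1)] *[OF _ qS_qUpow(2) halves(2)]
            *[OF _ qS_qUpow(3) halves(3)] *[OF _ qS_qUpow(4) halves(4)] *[OF _ qS_qUpow(5) units(3)]
            simp del: One_nat_def bex_simps)
    next
      case 3
      show ?thesis
      proof (cases "k = 4")
        \<comment> \<open>The cycle closes here: U^5 = -1 lies in the coset of 1.\<close>
        case True
        then show ?thesis unfolding 3 k(2)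
          by (intro *[of 0 _ "quat (-1) 0 0 0"]) (use units in \<open>simp_all add: qU_step qUpow(1) quat_mult_one\<close>)
      next
        case False
        then show ?thesis unfolding 3 k(2) using k(1)
          by (intro *[of "Suc k" _ "quat 1 0 0 0"]) (use units in \<open>simp_all add: qU_step quat_mult_one\<close>)
      qed
    qed
  qed
  \<comment> \<open>Distinct powers of U have as inner product the cosine of a multiple of 36
    degrees, never a real part occurring in T.\<close>
  have disj: "c = c'" if cc: "c \<in> ?C" "c' \<in> ?C" "c' \<in> left_coset c binT" for c c'
  proof (rule ccontr)
    assume ne: "c \<noteq> c'"
    obtain k k' where k: "k < 5" "c = qUpow k" "k' < 5" "c' = qUpow k'" using cc by auto
    have "c \<bullet> c' \<in> {golden/2, - golden/2, (golden - 1)/2, - (golden - 1)/2}"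
      using ne k(1,3) unfolding k(2,4) less_5_cases
      by (auto simp: qUpow inner_quat field_simps golden_mult)
    moreover have "norm c = 1" using k norm_qUpow by simp
    then have "c \<bullet> c' \<in> {0, 1/2, -1/2, 1, -1}"
      using inner_left_coset[OF _ cc(3)] binT_re by metis
    ultimately show False using golden_bounds by auto
  qed
  show "transversal ?C binT binI" "finite binI"
    unfolding binI_def
    by (rule transversal_generate[OF X subgroup_binT transversal_binT(2) T _ C 1 step disj]; simp)+
qed

lemma subgroup_binI: "subgroup binI SU2"
  unfolding binI_def by (rule subgroup_generate) (simp add: norm_gens)

lemma card_binI: "card binI = 120"
proof -
  have "card (qUpow ` {..<5}) = 5"
    by (simp add: card_image[OF inj_qUpow])
  then show ?thesis
    using card_transversal[OF transversal_binI(1) subgroup_binT transversal_binT(2)] by (simp add: card_binT)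
qed

section \<open>The binary dihedral groups of even index\<close>

lemma qE_add: "qE s \<odot> qE t = qE (s + t)"
  by (simp add: qE_def quat_mult_quat quat_eq cos_add sin_add algebra_simps)

lemma inner_qE: "qE s \<bullet> qE t = cos (s - t)"
  by (simp add: qE_def inner_quat cos_diff)

lemma qR_eq_qE: "qR n = qE (pi / real n)"
  by (simp add: qR_def qE_def)

lemma inj_qE_angles:
  assumes "0 < h"
  shows "inj_on (\<lambda>m. qE (real m * pi / real (2 * h))) {..<h}"
proof (rule inj_onI)
  fix m m' assume m: "m \<in> {..<h}" "m' \<in> {..<h}"
    and eq: "qE (real m * pi / real (2 * h)) = qE (real m' * pi / real (2 * h))"
  have bd: "0 \<le> real x * pi / real (2 * h)" "real x * pi / real (2 * h) \<le> pi" if "x \<in> {..<h}" for x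
    using that assms by (auto simp: field_simps)
  have "cos (real m * pi / real (2 * h)) = cos (real m' * pi / real (2 * h))"
    using eq by (simp add: qE_def quat_eq)
  then have "real m * pi / real (2 * h) = real m' * pi / real (2 * h)"
    by (rule cos_inj_pi[OF bd(1)[OF m(1)] bd(2)[OF m(1)] bd(1)[OF m(2)] bd(2)[OF m(2)]])
  then show "m = m'" using assms by simp
qed

text \<open>With even index 2 h the h-th power of R is i, so V lies in the group, and the powers
  with angle below pi / 2 represent its cosets.\<close>

lemma transversal_binD:
  assumes h: "0 < h"
  shows "transversal ((\<lambda>m. qE (real m * pi / real (2 * h))) ` {..<h}) binV (binD (2 * h))"
    "finite (binD (2 * h))"
proof -
  define a where "a m = real m * pi / real (2 * h)" for m
  have a_Suc: "pi / real (2 * h) + a m = a (Suc m)" for m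
    by (simp add: a_def add_divide_distrib[symmetric] algebra_simps)
  have a_h: "a h = pi / 2" using h by (simp add: a_def)
  have qE_half: "qE (pi / 2) = qA1" by (simp add: qE_def qA1_def)
  let ?C = "(\<lambda>m. qE (a m)) ` {..<h}"
  let ?X = "{qA2, qR (2 * h)}"
  have X: "?X \<subseteq> carrier SU2" using norm_gens norm_qR by simp
  have R: "qR (2 * h) = qE (pi / real (2 * h))" by (rule qR_eq_qE)
  have pow: "qE (a m) \<in> generate SU2 ?X" for m
  proof (induction m)
    case 0 show ?case using generate_one by (simp add: a_def qE_def)
  next
    case (Suc m)
    have "qR (2 * h) \<in> generate SU2 ?X" by (auto intro: generate.incl)
    from generate_mult[OF this Suc] show ?case by (simp only: R qE_add a_Suc)
  qed
  then have C: "?C \<subseteq> generate SU2 ?X" by auto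
  have "quat 1 0 0 0 = qE (a 0)" by (simp add: a_def qE_def)
  then have 1: "quat 1 0 0 0 \<in> ?C" using h by blast
  have "qA1 \<in> generate SU2 ?X" using pow[of h] by (simp add: a_h qE_half)
  then have V: "binV \<subseteq> generate SU2 ?X"
    using X by (intro binV_subset_generate) (auto intro: generate.incl)
  have step: "\<exists>c'\<in>?C. x \<odot> c \<in> left_coset c' binV" if x: "x \<in> ?X" and c: "c \<in> ?C" for x c
  proof -
    have *: "\<exists>c'\<in>?C. y \<in> left_coset c' binV" if "k < h" "y = qE (a k) \<odot> n" "n \<in> binV" for y k n
      using that by (auto intro!: bexI[of _ "qE (a k)"] simp: left_coset_def)
    have units: "qA1 \<in> binV" "qA2 \<in> binV" "quat 1 0 0 0 \<in> binV" "quat 0 0 0 (-1) \<in> binV"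
      by (auto simp: binV_eq qA1_def qA2_def)
    obtain m where m: "m < h" "c = qE (a m)" using c by auto
    show ?thesis
    proof (cases "x = qA2")
      case True
      show ?thesis
      proof (cases "m = 0")
        case True
        then show ?thesis unfolding \<open>x = qA2\<close> m(2) using h units
          by (intro *[of 0 _ qA2]) (simp_all add: a_def qE_def quat_mult_one)
      next
        case False
        \<comment> \<open>j exp (i a) = exp (-i a) j = exp (i (pi / 2 - a)) (-i) j, and (-i) j =
          -k.\<close>
        have "a (h - m) = pi / 2 - a m"
          using m(1) h by (simp add: a_def of_nat_diff field_simps)
        then have "qA2 \<odot> qE (a m) = qE (a (h - m)) \<odot> quat 0 0 0 (-1)"
          by (simp add: qE_def qA2_def quat_mult_quat quat_eq sin_diff cos_diff)
        then show ?thesis unfolding \<open>x = qA2\<close> m(2) using False m(1) units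
          by (intro *[of "h - m" _ "quat 0 0 0 (-1)"]) auto
      qed
    next
      case False
      then have "x = qE (pi / real (2 * h))" using x R by auto
      then have xc: "x \<odot> c = qE (a (Suc m))" by (simp only: m(2) qE_add a_Suc)
      show ?thesis
      proof (cases "Suc m = h")
        case True
        then show ?thesis unfolding xc using h units
          by (intro *[of 0 _ qA1]) (simp_all add: a_h qE_half, simp add: a_def qE_def quat_mult_one)
      next
        case False
        then show ?thesis unfolding xc using m(1) units
          by (intro *[of "Suc m" _ "quat 1 0 0 0"]) (simp_all add: quat_mult_one)
      qed
    qed
  qed
  have disj: "c = c'" if cc: "c \<in> ?C" "c' \<in> ?C" "c' \<in> left_coset c binV" for c c'
  proof -
    obtain m m' where m: "m < h" "c = qE (a m)" "m' < h" "c' = qE (a m')" using cc by auto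
    have bd: "0 \<le> a x" "a x < pi / 2" if "x < h" for x
      using that h by (auto simp: a_def field_simps)
    \<comment> \<open>Angles closer than pi / 2 have a positive cosine, and the only positive real
      part in V is 1, which forces equal angles.\<close>
    have d: "\<bar>a m - a m'\<bar> < pi / 2" using bd[OF m(1)] bd[OF m(3)] by linarith
    then have pos: "cos (a m - a m') > 0" by (intro cos_gt_zero_pi; linarith)
    have "cos (a m - a m') \<in> {0, 1, -1}"
      using inner_left_coset[OF _ cc(3)] binV_re m by (metis inner_qE norm_qE)
    with pos have "cos \<bar>a m - a m'\<bar> = cos 0" by auto
    moreover have "\<bar>a m - a m'\<bar> \<le> pi" using d pi_gt_zero by linarith
    ultimately have "\<bar>a m - a m'\<bar> = 0" using cos_inj_pi[of "\<bar>a m - a m'\<bar>" 0] by simp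
    then show ?thesis using m by simp
  qed
  have "transversal ?C binV (generate SU2 ?X) \<and> finite (generate SU2 ?X)"
    using transversal_generate[OF X subgroup_binV finite_binV V _ C 1 step disj] by simp
  then show "transversal ((\<lambda>m. qE (real m * pi / real (2 * h))) ` {..<h}) binV (binD (2 * h))"
    "finite (binD (2 * h))"
    by (simp_all add: binD_def a_def)
qed

lemma subgroup_binD: "subgroup (binD n) SU2"
  unfolding binD_def by (rule subgroup_generate) (simp add: norm_gens norm_qR)

lemma card_binD:
  assumes "0 < h"
  shows "card (binD (2 * h)) = 8 * h"
  using card_transversal[OF transversal_binD(1)[OF assms] subgroup_binV finite_binV]
  by (simp only: card_image[OF inj_qE_angles[OF assms]]) (simp add: card_binV)

section \<open>Multiplicities and the table\<close>

text \<open>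
  The entry at index n is the multiplicity of the trivial representation of G in the
  representation of SU(2) of dimension 2 n + 1. The list of partial sums starts at index 1, since
  indices 1 to 6 are the degrees 2 to 12.
\<close>

definition has_mults :: "(real^4) set \<Rightarrow> nat list \<Rightarrow> bool" where
  "has_mults G ms \<longleftrightarrow> subgroup G SU2 \<and> finite G \<and> length ms = 7 \<and>
     (\<forall>n<7. char_sum (2 * n) G = real (card G) * real (ms ! n))"

definition partial_sums :: "nat list \<Rightarrow> nat list" where
  "partial_sums w = map (\<lambda>n. \<Sum>m\<le>n. w ! m) [1, 2, 3, 4, 5, 6]"

lemma sum_even_part: "(\<Sum>k\<le>(2 * n) div 2. g (2 * n - 2 * k)) = (\<Sum>m\<le>n. g (2 * m))"
  for g :: "nat \<Rightarrow> real"
proof -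
  have "(\<Sum>k\<le>n. g (2 * n - 2 * k)) = (\<Sum>m\<le>n. g (2 * m))"
    by (rule sum.reindex_bij_witness[where i = "\<lambda>m. n - m" and j = "\<lambda>k. n - k"])
      (auto simp: diff_mult_distrib2)
  then show ?thesis by simp
qed

lemma inv_dims_eqI:
  assumes "\<And>n. n < 7 \<Longrightarrow> inv_dim G (2 * n) = (\<Sum>m\<le>n. w ! m)"
  shows "inv_dims G = partial_sums w"
  using assms[of 1] assms[of 2] assms[of 3] assms[of 4] assms[of 5] assms[of 6]
  by (simp add: inv_dims_def partial_sums_def)

lemma card_subgroup_nonzero: "subgroup G SU2 \<Longrightarrow> finite G \<Longrightarrow> card G \<noteq> 0"
  by (metis card_0_eq empty_iff subgroup.one_closed)

text \<open>In V_2m \<otimes> V_2m the invariants of a product group are the tensor product of the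
  invariants of its factors, so multiplicities multiply; degree 2 n contains these pieces for all m
  \<le> n.\<close>

lemma inv_dims_prod_grp:
  assumes "has_mults G ms" "has_mults G' ms'"
  shows "inv_dims (prod_grp G G') = partial_sums (map2 (*) ms ms')"
proof (rule inv_dims_eqI)
  fix n :: nat assume n: "n < 7"
  have G: "subgroup G SU2" "finite G" "subgroup G' SU2" "finite G'" "length ms = 7" "length ms' = 7"
    using assms by (auto simp: has_mults_def)
  have card: "card G \<noteq> 0" "card G' \<noteq> 0"
    using G card_subgroup_nonzero by blast+
  have "real (card G) * real (card G') * real (inv_dim (prod_grp G G') (2 * n)) =
      (\<Sum>m\<le>n. char_sum (2 * m) G * char_sum (2 * m) G')"
    using inv_dim_prod_grp[OF G(1-4), of "2 * n"]
      sum_even_part[where n = n and g = "\<lambda>l. char_sum l G * char_sum l G'"] by simp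
  also have "\<dots> = (\<Sum>m\<le>n. real (card G) * real (card G') * real (map2 (*) ms ms' ! m))"
    using assms n G(5,6) by (intro sum.cong) (auto simp: has_mults_def)
  also have "\<dots> = real (card G) * real (card G') * real (\<Sum>m\<le>n. map2 (*) ms ms' ! m)"
    by (simp add: sum_distrib_left)
  finally show "inv_dim (prod_grp G G') (2 * n) = (\<Sum>m\<le>n. map2 (*) ms ms' ! m)"
    using card by (simp del: of_nat_sum)
qed

text \<open>\<open>char_sum\<close> over c N divided by |N| is the character, at c, of G/N on the
  N-invariants of V_2m. Hence \<open>w ! m\<close> is the sum of the squared multiplicities of the
  irreducible characters of G/N.\<close>

lemma inv_dims_fiber_grp:
  assumes G: "subgroup G SU2" "finite G" and N: "subgroup N SU2" "N \<subseteq> G"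
    and C: "transversal C N G"
    and normal: "\<And>c n. c \<in> C \<Longrightarrow> n \<in> N \<Longrightarrow> \<exists>n'\<in>N. n \<odot> c = c \<odot> n'"
    and w: "\<And>m. m < 7 \<Longrightarrow> (\<Sum>c\<in>C. (char_sum (2 * m) (left_coset c N))\<^sup>2)
      = real (card G) * real (card N) * real (w ! m)"
  shows "inv_dims (fiber_grp G N) = partial_sums w"
proof (rule inv_dims_eqI)
  fix n :: nat assume n: "n < 7"
  have "finite N" using G(2) N(2) by (rule finite_subset[rotated])
  then have card: "card G \<noteq> 0" "card N \<noteq> 0"
    using G N card_subgroup_nonzero by blast+
  have "real (card G) * real (card N) * real (inv_dim (fiber_grp G N) (2 * n)) =
      (\<Sum>m\<le>n. \<Sum>c\<in>C. (char_sum (2 * m) (left_coset c N))\<^sup>2)"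
    using inv_dim_fiber_grp[OF G N normal_transversal[OF N(1) C normal] C, of "2 * n"]
      sum_even_part[where n = n and g = "\<lambda>l. \<Sum>c\<in>C. (char_sum l (left_coset c N))\<^sup>2"] by simp
  also have "\<dots> = (\<Sum>m\<le>n. real (card G) * real (card N) * real (w ! m))"
    using n by (intro sum.cong) (auto simp: w)
  also have "\<dots> = real (card G) * real (card N) * real (\<Sum>m\<le>n. w ! m)"
    by (simp add: sum_distrib_left)
  finally show "inv_dim (fiber_grp G N) (2 * n) = (\<Sum>m\<le>n. w ! m)"
    using card by (simp del: of_nat_sum)
qed

section \<open>Evaluation of the characters and multiplicities for the binary groups\<close>

lemma less_7_cases: "(\<forall>n<7. P n) \<longleftrightarrow> P 0 \<and> P (Suc 0) \<and> P 2 \<and> P 3 \<and> P 4 \<and> P 5 \<and> P (6::nat)"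
proof -
  have "n < 7 \<longleftrightarrow> n \<in> {0, Suc 0, 2, 3, 4, 5, 6}" for n :: nat by auto
  then show ?thesis by auto
qed

lemma chi_even_table:
  "chi_even 0 y = (1 :: 'a::comm_ring_1)" "chi_even (Suc 0) y = y + 1"
  "chi_even 2 y = y * (y + 1) - 1"
  "chi_even 3 y = y * chi_even 2 y - (y + 1)"
  "chi_even 4 y = y * chi_even 3 y - chi_even 2 y"
  "chi_even 5 y = y * chi_even 4 y - chi_even 3 y"
  "chi_even 6 y = y * chi_even 5 y - chi_even 4 y"
  by (simp_all add: numeral_eq_Suc)

text \<open>The roots of y^2 + y = 1 are 2 cos 72 and 2 cos 144 (degrees), so the values have period
  five in n and stay linear in y.\<close>

lemma chi_even_table_golden:
  fixes y :: "'a::comm_ring_1"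
  assumes "y * y = 1 - y"
  shows "chi_even 2 y = 0" "chi_even 3 y = - y - 1" "chi_even 4 y = -1" "chi_even 5 y = 1"
    "chi_even 6 y = y + 1"
proof -
  show *: "chi_even 2 y = 0" "chi_even 3 y = - y - 1"
    using assms by (simp_all add: chi_even_table algebra_simps)
  show **: "chi_even 4 y = -1"
    unfolding chi_even_table(5) * using assms by (simp add: algebra_simps)
  show ***: "chi_even 5 y = 1"
    unfolding chi_even_table(6) * ** by simp
  show "chi_even 6 y = y + 1"
    unfolding chi_even_table(7) ** *** by simp
qed

text \<open>y = sqrt 2 and y = - sqrt 2 come from the odd powers of R_8, whose doubled angles are 45
  and 135 degrees among the representatives.\<close>

lemma chi_even_table_sqrt2:
  fixes y :: "'a::comm_ring_1"
  assumes "y * y = 2"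
  shows "chi_even 2 y = y + 1" "chi_even 3 y = 1" "chi_even 4 y = -1" "chi_even 5 y = - y - 1"
    "chi_even 6 y = - y - 1"
proof -
  show *: "chi_even 2 y = y + 1" "chi_even 3 y = 1"
    using assms by (simp_all add: chi_even_table algebra_simps)
  show **: "chi_even 4 y = -1"
    unfolding chi_even_table(5) * by simp
  show ***: "chi_even 5 y = - y - 1"
    unfolding chi_even_table(6) * ** by simp
  show "chi_even 6 y = - y - 1"
    unfolding chi_even_table(7) ** *** using assms by (simp add: algebra_simps)
qed

lemma left_coset_one: "left_coset (quat 1 0 0 0) N = N"
  by (simp add: left_coset_def quat_mult_one)

lemma char_sum_binV: "char_sum (2 * n) binV = 2 * (chi_even n 2 + 3 * chi_even n (-2))"
proof -
  have "norm (quat 1 0 0 0) = 1" by (simp add: norm_quat_1)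
  from char_sum_left_coset_binV[OF this, of n] show ?thesis
    by (simp add: left_coset_one coset_char_def)
qed

lemma has_mults_binV: "has_mults binV [1, 0, 2, 1, 3, 2, 4]"
  unfolding has_mults_def less_7_cases char_sum_binV card_binV
  by (simp add: subgroup_binV finite_binV chi_even_table)

lemma coset_char_binT:
  "coset_char n (quat 1 0 0 0) = 2 * (chi_even n 2 + 3 * chi_even n (-2))"
  "coset_char n qS = 8 * chi_even n (-1)" "coset_char n qS2 = 8 * chi_even n (-1)"
  by (simp_all add: coset_char_def qS_def qS2_def power_divide)

lemma sum_binT_reps:
  "(\<Sum>c\<in>{quat 1 0 0 0, qS, qS2}. f c) = f (quat 1 0 0 0) + f qS + (f qS2 :: real)"
  by (simp add: qS_def qS2_def quat_eq)

lemma norm_binT_reps: "norm (quat 1 0 0 0) = 1" "norm qS = 1" "norm qS2 = 1"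
  by (simp_all add: norm_gens qS2_def norm_quat_1 power_divide)

lemma char_sum_left_coset_binT:
  assumes "norm c = 1"
  shows "char_sum (2 * n) (left_coset c binT) =
    coset_char n c + coset_char n (c \<odot> qS) + coset_char n (c \<odot> qS2)"
  unfolding transversal_left_coset[OF transversal_binT(1) subgroup_binV finite_binV assms
      subgroup.subset[OF subgroup_binT]] sum_binT_reps
  using assms by (simp add: char_sum_left_coset_binV norm_quat_mult norm_binT_reps quat_mult_one)

lemma char_sum_binT:
  "char_sum (2 * n) binT = 2 * (chi_even n 2 + 3 * chi_even n (-2)) + 16 * chi_even n (-1)"
  using char_sum_left_coset_binT[OF norm_binT_reps(1), of n]
  by (simp add: left_coset_one quat_mult_one coset_char_binT)

lemma has_mults_binT: "has_mults binT [1, 0, 0, 1, 1, 0, 2]"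
  unfolding has_mults_def less_7_cases char_sum_binT card_binT
  by (simp add: subgroup_binT transversal_binT chi_even_table)

text \<open>Each representative outside T has two coordinates of square 1/2 and two that vanish,
  which give y = 0 and y = -2.\<close>

lemma coset_char_binO:
  "coset_char n (qR 4) = 4 * (chi_even n 0 + chi_even n (-2))"
  "coset_char n (qR 4 \<odot> qS) = 4 * (chi_even n 0 + chi_even n (-2))"
  "coset_char n (qR 4 \<odot> qS2) = 4 * (chi_even n 0 + chi_even n (-2))"
  by (simp_all add: coset_char_def qR4_eq qS_def qS2_def quat_mult_quat power_divide)

lemma char_sum_left_coset_qR4_binT:
  "char_sum (2 * n) (left_coset (qR 4) binT) = 12 * (chi_even n 0 + chi_even n (-2))"
  by (simp add: char_sum_left_coset_binT norm_qR coset_char_binO)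

lemma sum_binO_reps: "(\<Sum>c\<in>{quat 1 0 0 0, qR 4}. f c) = f (quat 1 0 0 0) + (f (qR 4) :: real)"
  by (simp add: qR4_eq quat_eq)

text \<open>The entries at 4 and 6 count the octahedral binary form of degree 8 and the square of
  the one of degree 6.\<close>

lemma has_mults_binO: "has_mults binO [1, 0, 0, 0, 1, 0, 1]"
  unfolding has_mults_def less_7_cases card_binO
    char_sum_transversal[OF transversal_binO(1) subgroup_binT transversal_binT(2)] sum_binO_reps
    left_coset_one char_sum_binT char_sum_left_coset_qR4_binT
  by (simp add: subgroup_binO transversal_binO chi_even_table)

lemma golden_squares:
  "4 * (golden / 2)\<^sup>2 - 2 = golden - 1" "4 * (- golden / 2)\<^sup>2 - 2 = golden - 1"
  "4 * ((golden - 1) / 2)\<^sup>2 - 2 = - golden" "4 * ((1 - golden) / 2)\<^sup>2 - 2 = - golden"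
  "4 * (1 / 2)\<^sup>2 - 2 = (-1 :: real)" "4 * (- 1 / 2)\<^sup>2 - 2 = (-1 :: real)"
  "4 * 0\<^sup>2 - 2 = (-2 :: real)"
  by (simp_all add: power2_eq_square field_simps golden_mult)

lemma qUpow_qS:
  "qUpow 1 \<odot> qS = quat ((golden - 1)/2) (golden/2) 0 (1/2)"
  "qUpow 1 \<odot> qS2 = quat (- 1/2) (golden/2) ((1 - golden)/2) 0"
  "qUpow 2 \<odot> qS = quat 0 (golden/2) (1/2) ((golden - 1)/2)"
  "qUpow 2 \<odot> qS2 = quat ((1 - golden)/2) (golden/2) 0 (- 1/2)"
  "qUpow 3 \<odot> qS = quat ((1 - golden)/2) (1/2) (golden/2) 0"
  "qUpow 3 \<odot> qS2 = quat 0 (1/2) ((golden - 1)/2) (- golden/2)"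
  "qUpow 4 \<odot> qS = quat (- 1/2) 0 (golden/2) ((1 - golden)/2)"
  "qUpow 4 \<odot> qS2 = quat ((golden - 1)/2) 0 (1/2) (- golden/2)"
  by (simp_all add: qUpow qS_def qS2_def quat_mult_quat quat_eq field_simps)

text \<open>Up to order and sign all twelve representatives have the coordinates golden/2, (golden -
  1)/2, 1/2, 0, so their cosets contribute equally.\<close>

lemma coset_char_golden:
  assumes "k \<in> {1, 2, 3, 4}" "d \<in> {quat 1 0 0 0, qS, qS2}"
  shows "coset_char n (qUpow k \<odot> d) =
    2 * (chi_even n (golden - 1) + chi_even n (- golden) + chi_even n (-1) + chi_even n (-2))"
  using assms
  by (elim insertE emptyE; hypsubst;
      simp only: quat_mult_one qUpow_qS;
      simp only: qUpow[folded One_nat_def] coset_char_def quat_nth golden_squares; simp)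

lemma char_sum_binI:
  "char_sum (2 * n) binI = char_sum (2 * n) binT +
    24 * (chi_even n (golden - 1) + chi_even n (- golden) + chi_even n (-1) + chi_even n (-2))"
proof -
  have "char_sum (2 * n) (left_coset (qUpow k) binT) =
    6 * (chi_even n (golden - 1) + chi_even n (- golden) + chi_even n (-1) + chi_even n (-2))"
    if "k \<in> {1, 2, 3, 4}" for k
    using coset_char_golden[OF that, of "quat 1 0 0 0"] coset_char_golden[OF that, of qS]
      coset_char_golden[OF that, of qS2]
    by (simp add: char_sum_left_coset_binT norm_qUpow quat_mult_one)
  moreover have "char_sum (2 * n) binI = (\<Sum>k<5. char_sum (2 * n) (left_coset (qUpow k) binT))"
    unfolding char_sum_transversal[OF transversal_binI(1) subgroup_binT transversal_binT(2)]
    by (simp add: sum.reindex[OF inj_qUpow])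
  moreover have "{..<5} = {0, 1, 2, 3, 4::nat}" by auto
  ultimately show ?thesis by (simp add: qUpow(1) left_coset_one)
qed

text \<open>The entry at 6 is Klein's form of degree 12, vanishing at the vertices of the
  icosahedron.\<close>

lemma has_mults_binI: "has_mults binI [1, 0, 0, 0, 0, 0, 1]"
proof -
  have "(golden - 1) * (golden - 1) = 1 - (golden - 1)" "- golden * - golden = 1 - - golden"
    by (simp_all add: algebra_simps golden_mult)
  note golden_table = this[THEN chi_even_table_golden(1)] this[THEN chi_even_table_golden(2)]
    this[THEN chi_even_table_golden(3)] this[THEN chi_even_table_golden(4)]
    this[THEN chi_even_table_golden(5)]
  show ?thesis
    unfolding has_mults_def less_7_cases card_binI char_sum_binI char_sum_binT golden_table
    by (simp add: subgroup_binI transversal_binI chi_even_table)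
qed

lemma char_sum_binD:
  assumes "0 < h"
  shows "char_sum (2 * n) (binD (2 * h)) = (\<Sum>m<h. 2 * (chi_even n (2 * cos (real m * pi / real h)) +
    chi_even n (- (2 * cos (real m * pi / real h))) + 2 * chi_even n (-2)))"
proof -
  have "char_sum (2 * n) (binD (2 * h)) =
      (\<Sum>m<h. coset_char n (qE (real m * pi / real (2 * h))))"
    unfolding char_sum_transversal[OF transversal_binD(1)[OF assms] subgroup_binV finite_binV]
    by (subst sum.reindex[OF inj_qE_angles[OF assms]]) (simp add: char_sum_left_coset_binV)
  also have "\<dots> = (\<Sum>m<h. 2 * (chi_even n (2 * cos (real m * pi / real h)) +
    chi_even n (- (2 * cos (real m * pi / real h))) + 2 * chi_even n (-2)))"
  proof (rule sum.cong[OF refl])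
    fix m
    \<comment> \<open>Passing to y = 4 x^2 - 2 doubles the angle, so the denominator 2 h becomes h;
      cosine and sine give opposite values.\<close>
    define t where "t = real m * pi / real (2 * h)"
    have "real m * pi / real h = 2 * t" by (simp add: t_def)
    moreover have "4 * (cos t)\<^sup>2 - 2 = 2 * cos (2 * t)"
      by (simp add: cos_double_cos)
    moreover have "4 * (sin t)\<^sup>2 - 2 = - (2 * cos (2 * t))"
      by (simp add: cos_double_sin)
    ultimately show "coset_char n (qE (real m * pi / real (2 * h))) =
      2 * (chi_even n (2 * cos (real m * pi / real h)) +
        chi_even n (- (2 * cos (real m * pi / real h))) + 2 * chi_even n (-2))"
      unfolding t_def[symmetric] by (simp add: coset_char_def qE_def)
  qed
  finally show ?thesis .
qed

lemma lessThan_small: "{..<2::nat} = {0, 1}" "{..<3::nat} = {0, 1, 2}" "{..<4::nat} = {0, 1, 2, 3}"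
  by auto

lemma has_mults_binD4: "has_mults (binD 4) [1, 0, 1, 0, 2, 1, 2]"
proof -
  have "char_sum (2 * n) (binD 4) =
      2 * (chi_even n 2 + 3 * chi_even n (-2)) + 4 * (chi_even n 0 + chi_even n (-2))" for n
    using char_sum_binD[of 2 n] by (simp add: lessThan_small)
  then show ?thesis
    using card_binD[of 2] transversal_binD(2)[of 2]
    by (simp add: has_mults_def less_7_cases subgroup_binD chi_even_table)
qed

lemma has_mults_binD6: "has_mults (binD 6) [1, 0, 1, 0, 1, 0, 2]"
proof -
  have "2 * pi / 3 = pi - pi / 3" by simp
  then have "cos (2 * pi / 3) = - 1 / 2" by (simp only: cos_pi_minus cos_60)
  then have "char_sum (2 * n) (binD 6) = 2 * (chi_even n 2 + 3 * chi_even n (-2))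
      + 4 * (chi_even n 1 + chi_even n (-1) + 2 * chi_even n (-2))" for n
    using char_sum_binD[of 3 n] by (simp add: lessThan_small cos_60)
  then show ?thesis
    using card_binD[of 3] transversal_binD(2)[of 3]
    by (simp add: has_mults_def less_7_cases subgroup_binD chi_even_table)
qed

lemma has_mults_binD8: "has_mults (binD 8) [1, 0, 1, 0, 1, 0, 1]"
proof -
  have "3 * pi / 4 = pi - pi / 4" by simp
  then have "cos (3 * pi / 4) = - sqrt 2 / 2" by (simp only: cos_pi_minus cos_45)
  then have "char_sum (2 * n) (binD 8) = 2 * (chi_even n 2 + 3 * chi_even n (-2))
      + 4 * (chi_even n 0 + chi_even n (-2))
      + 4 * (chi_even n (sqrt 2) + chi_even n (- sqrt 2) + 2 * chi_even n (-2))" for n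
    using char_sum_binD[of 4 n] by (simp add: lessThan_small cos_45)
  moreover have "sqrt 2 * sqrt 2 = 2" "- sqrt 2 * - sqrt 2 = 2" by simp_all
  note sqrt2_table = this[THEN chi_even_table_sqrt2(1)] this[THEN chi_even_table_sqrt2(2)]
    this[THEN chi_even_table_sqrt2(3)] this[THEN chi_even_table_sqrt2(4)]
    this[THEN chi_even_table_sqrt2(5)]
  ultimately show ?thesis
    using card_binD[of 4] transversal_binD(2)[of 4]
    by (simp add: has_mults_def less_7_cases subgroup_binD sqrt2_table) (simp add: chi_even_table)
qed

section \<open>Fibre products\<close>

text \<open>Conjugation by S permutes i, j, k cyclically up to sign; conjugation by R_4 fixes i and
  turns j into k up to sign.\<close>

lemma binV_normalized:
  assumes "c \<in> {quat 1 0 0 0, qS, qS2, qR 4}" "n \<in> binV"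
  shows "\<exists>n'\<in>binV. n \<odot> c = c \<odot> n'"
  unfolding binV_def
proof (rule normalize_generate)
  show "{qA1, qA2} \<subseteq> carrier SU2" "norm c = 1" "n \<in> generate SU2 {qA1, qA2}"
    using assms norm_gens norm_binT_reps norm_qR by (auto simp: binV_def)
  have eqs: "qA1 \<odot> qS = qS \<odot> quat 0 0 (-1) 0" "qA2 \<odot> qS = qS \<odot> quat 0 0 0 (-1)"
    "qA1 \<odot> qS2 = qS2 \<odot> quat 0 0 0 1" "qA2 \<odot> qS2 = qS2 \<odot> quat 0 (-1) 0 0"
    "qA1 \<odot> qR 4 = qR 4 \<odot> quat 0 1 0 0" "qA2 \<odot> qR 4 = qR 4 \<odot> quat 0 0 0 (-1)"
    by (simp_all add: qA1_def qA2_def qS_def qS2_def qR4_eq quat_mult_quat quat_eq)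
  have "\<exists>n'\<in>binV. x \<odot> c = c \<odot> n'" if "x \<in> {qA1, qA2}" for x
    using that assms(1) unfolding binV_eq
    by (elim insertE emptyE; hypsubst; simp only: eqs quat_mult_one)
      (auto simp: qA1_def qA2_def)
  then show "\<exists>n'\<in>generate SU2 {qA1, qA2}. x \<odot> c = c \<odot> n'" if "x \<in> {qA1, qA2}" for x
    using that by (simp add: binV_def)
qed

lemma binT_normalized:
  assumes "c \<in> {quat 1 0 0 0, qR 4}" "n \<in> binT"
  shows "\<exists>n'\<in>binT. n \<odot> c = c \<odot> n'"
  unfolding binT_def
proof (rule normalize_generate)
  show "{qA1, qS} \<subseteq> carrier SU2" "norm c = 1" "n \<in> generate SU2 {qA1, qS}"
    using assms norm_gens norm_binT_reps norm_qR by (auto simp: binT_def)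
  have gens: "qA1 \<in> binT" "qS \<in> binT" by (auto simp: binT_def intro: generate.incl)
  have half: "quat (1/2) (1/2) (1/2) (1/2) \<in> binT" by (rule half_quat_in_binT) simp
  have "qA1 \<odot> qR 4 = qR 4 \<odot> qA1" "qS \<odot> qR 4 = qR 4 \<odot> quat (1/2) (1/2) (1/2) (1/2)"
    by (simp_all add: qA1_def qS_def qR4_eq quat_mult_quat quat_eq)
  then have "\<exists>n'\<in>binT. x \<odot> c = c \<odot> n'" if "x \<in> {qA1, qS}" for x
    using that assms(1) gens half by (auto simp: quat_mult_one)
  then show "\<exists>n'\<in>generate SU2 {qA1, qS}. x \<odot> c = c \<odot> n'" if "x \<in> {qA1, qS}" for x
    using that by (simp add: binT_def)
qed

text \<open>T/V is cyclic of order three, and its two nontrivial characters occur equally often.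
  Each entry is a^2 + 2 b^2, where a is the entry of T and a + 2 b that of V.\<close>

lemma inv_dims_binT_binV: "inv_dims (fiber_grp binT binV) = partial_sums [1, 0, 2, 1, 3, 2, 6]"
proof (rule inv_dims_fiber_grp[OF subgroup_binT transversal_binT(2) subgroup_binV
      binV_subset_binT transversal_binT(1)])
  show "\<exists>n'\<in>binV. n \<odot> c = c \<odot> n'" if "c \<in> {quat 1 0 0 0, qS, qS2}" "n \<in> binV" for c n
    using that by (intro binV_normalized) auto
  have "\<forall>m<7. (\<Sum>c\<in>{quat 1 0 0 0, qS, qS2}. (char_sum (2 * m) (left_coset c binV))\<^sup>2) =
      real (card binT) * real (card binV) * real ([1, 0, 2, 1, 3, 2, 6] ! m)"
    unfolding sum_binT_reps char_sum_left_coset_binV[OF norm_binT_reps(1)]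
      char_sum_left_coset_binV[OF norm_binT_reps(2)] char_sum_left_coset_binV[OF norm_binT_reps(3)]
      coset_char_binT less_7_cases card_binT card_binV
    by (simp add: chi_even_table)
  then show "(\<Sum>c\<in>{quat 1 0 0 0, qS, qS2}. (char_sum (2 * m) (left_coset c binV))\<^sup>2) =
      real (card binT) * real (card binV) * real ([1, 0, 2, 1, 3, 2, 6] ! m)" if "m < 7" for m
    using that by blast
qed

lemma binT_subset_binO: "binT \<subseteq> binO"
  using transversal_binO(1) left_coset_one by (auto simp: transversal_def)

text \<open>O/T has two characters, with multiplicities o and t - o for the entries o of O and t of
  T. Both are 0 or 1 here, so the sum of squares is again t.\<close>

lemma inv_dims_binO_binT: "inv_dims (fiber_grp binO binT) = partial_sums [1, 0, 0, 1, 1, 0, 2]"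
proof (rule inv_dims_fiber_grp[OF subgroup_binO transversal_binO(2) subgroup_binT
      binT_subset_binO transversal_binO(1) binT_normalized])
  have "\<forall>m<7. (\<Sum>c\<in>{quat 1 0 0 0, qR 4}. (char_sum (2 * m) (left_coset c binT))\<^sup>2) =
      real (card binO) * real (card binT) * real ([1, 0, 0, 1, 1, 0, 2] ! m)"
    unfolding sum_binO_reps less_7_cases card_binO card_binT left_coset_one char_sum_binT
      char_sum_left_coset_qR4_binT
    by (simp add: chi_even_table)
  then show "(\<Sum>c\<in>{quat 1 0 0 0, qR 4}. (char_sum (2 * m) (left_coset c binT))\<^sup>2) =
      real (card binO) * real (card binT) * real ([1, 0, 0, 1, 1, 0, 2] ! m)" if "m < 7" for m
    using that by blast
qed

lemma inv_dims_binO_binV: "inv_dims (fiber_grp binO binV) = partial_sums [1, 0, 1, 1, 2, 1, 3]"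
proof -
  let ?f = "\<lambda>(c, d). c \<odot> d"
  let ?A = "{quat 1 0 0 0, qR 4} \<times> {quat 1 0 0 0, qS, qS2}"
  \<comment> \<open>The six products are distinct, so a sum over the representatives of V in O
    becomes a double sum over the factors.\<close>
  have inj: "inj_on ?f ?A"
    by (auto simp: inj_on_def qR4_eq qS_def qS2_def quat_mult_quat quat_eq)
  have tr: "transversal (?f ` ?A) binV binO"
    by (rule transversal_trans[OF transversal_binO(1) transversal_binT(1) subgroup_binV])
  show ?thesis
  proof (rule inv_dims_fiber_grp[OF subgroup_binO transversal_binO(2) subgroup_binV _ tr])
    show "binV \<subseteq> binO" using binV_subset_binT binT_subset_binO by blast
    show "\<exists>n'\<in>binV. n \<odot> c = c \<odot> n'" if cn: "c \<in> ?f ` ?A" "n \<in> binV" for c n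
    proof -
      obtain a b where ab: "c = a \<odot> b" "a \<in> {quat 1 0 0 0, qR 4}" "b \<in> {quat 1 0 0 0, qS, qS2}"
        using cn(1) by auto
      obtain n1 where n1: "n1 \<in> binV" "n \<odot> a = a \<odot> n1"
        using binV_normalized[of a n] ab(2) cn(2) by auto
      obtain n2 where "n2 \<in> binV" "n1 \<odot> b = b \<odot> n2"
        using binV_normalized[of b n1] ab(3) n1(1) by auto
      then show ?thesis using n1(2) ab(1) by (metis quat_mult_assoc)
    qed
    have "(\<Sum>c\<in>?f ` ?A. g c) = (\<Sum>a\<in>{quat 1 0 0 0, qR 4}. \<Sum>b\<in>{quat 1 0 0 0, qS, qS2}. g (a \<odot> b))"
      for g :: "_ \<Rightarrow> real"
      unfolding sum.reindex[OF inj] sum.cartesian_product by (rule sum.cong) auto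
    note sum = this[unfolded sum_binO_reps sum_binT_reps quat_mult_one]
    have "char_sum (2 * m) (left_coset c binV) = coset_char m c"
      if "c \<in> {quat 1 0 0 0, qS, qS2, qR 4, qR 4 \<odot> qS, qR 4 \<odot> qS2}" for m c
      using that by (intro char_sum_left_coset_binV)
        (auto simp: norm_quat_mult norm_binT_reps norm_qR)
    then have char_sum: "char_sum (2 * m) (left_coset (quat 1 0 0 0) binV) = 2 * (chi_even m 2 + 3 * chi_even m (-2))"
      "char_sum (2 * m) (left_coset qS binV) = 8 * chi_even m (-1)"
      "char_sum (2 * m) (left_coset qS2 binV) = 8 * chi_even m (-1)"
      "char_sum (2 * m) (left_coset (qR 4) binV) = 4 * (chi_even m 0 + chi_even m (-2))"
      "char_sum (2 * m) (left_coset (qR 4 \<odot> qS) binV) = 4 * (chi_even m 0 + chi_even m (-2))"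
      "char_sum (2 * m) (left_coset (qR 4 \<odot> qS2) binV) = 4 * (chi_even m 0 + chi_even m (-2))" for m
      by (simp_all add: coset_char_binT coset_char_binO)
    have "\<forall>m<7. (\<Sum>c\<in>?f ` ?A. (char_sum (2 * m) (left_coset c binV))\<^sup>2) =
        real (card binO) * real (card binV) * real ([1, 0, 1, 1, 2, 1, 3] ! m)"
      unfolding sum char_sum less_7_cases card_binO card_binV
      by (simp add: chi_even_table)
    then show "(\<Sum>c\<in>?f ` ?A. (char_sum (2 * m) (left_coset c binV))\<^sup>2) =
        real (card binO) * real (card binV) * real ([1, 0, 1, 1, 2, 1, 3] ! m)" if "m < 7" for m
      using that by blast
  qed
qed

lemma partial_sums_Cons:
  "partial_sums [a, b, c, d, e, f, g] = [a + b, a + b + c, a + b + c + d, a + b + c + d + e,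
    a + b + c + d + e + f, a + b + c + d + e + f + g]"
  by (simp add: partial_sums_def eval_nat_numeral)

theorem mainTheorem1:
  shows
    "inv_dims (prod_grp binV binV) = [1, 5, 6, 15, 19, 35] \<and>
     inv_dims (prod_grp binT binV) = [1, 1, 2, 5, 5, 13] \<and>
     inv_dims (prod_grp binT binT) = [1, 1, 2, 3, 3, 7] \<and>
     inv_dims (fiber_grp binT binV) = [1, 3, 4, 7, 9, 15] \<and>
     inv_dims (prod_grp binO binV) = [1, 1, 1, 4, 4, 8] \<and>
     inv_dims (prod_grp binO binT) = [1, 1, 1, 2, 2, 4] \<and>
     inv_dims (prod_grp binO binO) = [1, 1, 1, 2, 2, 3] \<and>
     inv_dims (fiber_grp binO binV) = [1, 2, 3, 5, 6, 9] \<and>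
     inv_dims (fiber_grp binO binT) = [1, 1, 2, 3, 3, 5] \<and>
     inv_dims (prod_grp binI binV) = [1, 1, 1, 1, 1, 5] \<and>
     inv_dims (prod_grp binI binT) = [1, 1, 1, 1, 1, 3] \<and>
     inv_dims (prod_grp binI binO) = [1, 1, 1, 1, 1, 2] \<and>
     inv_dims (prod_grp binI binI) = [1, 1, 1, 1, 1, 2] \<and>
     inv_dims (prod_grp binV (binD 4)) = [1, 3, 3, 9, 11, 19] \<and>
     inv_dims (prod_grp binV (binD 6)) = [1, 3, 3, 6, 6, 14] \<and>
     inv_dims (prod_grp binV (binD 8)) = [1, 3, 3, 6, 6, 10] \<and>
     inv_dims (prod_grp binT (binD 4)) = [1, 1, 1, 3, 3, 7] \<and>
     inv_dims (prod_grp binT (binD 6)) = [1, 1, 1, 2, 2, 6] \<and>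
     inv_dims (prod_grp binT (binD 8)) = [1, 1, 1, 2, 2, 4] \<and>
     inv_dims (prod_grp binO (binD 4)) = [1, 1, 1, 3, 3, 5] \<and>
     inv_dims (prod_grp binO (binD 6)) = [1, 1, 1, 2, 2, 4] \<and>
     inv_dims (prod_grp binO (binD 8)) = [1, 1, 1, 2, 2, 3] \<and>
     inv_dims (prod_grp binI (binD 4)) = [1, 1, 1, 1, 1, 3] \<and>
     inv_dims (prod_grp binI (binD 6)) = [1, 1, 1, 1, 1, 3] \<and>
     inv_dims (prod_grp binI (binD 8)) = [1, 1, 1, 1, 1, 2]"
  by (simp add: inv_dims_prod_grp[OF has_mults_binV has_mults_binV]
      inv_dims_prod_grp[OF has_mults_binT has_mults_binV] inv_dims_prod_grp[OF has_mults_binT has_mults_binT]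
      inv_dims_prod_grp[OF has_mults_binO has_mults_binV] inv_dims_prod_grp[OF has_mults_binO has_mults_binT]
      inv_dims_prod_grp[OF has_mults_binO has_mults_binO] inv_dims_prod_grp[OF has_mults_binI has_mults_binV]
      inv_dims_prod_grp[OF has_mults_binI has_mults_binT] inv_dims_prod_grp[OF has_mults_binI has_mults_binO]
      inv_dims_prod_grp[OF has_mults_binI has_mults_binI]
      inv_dims_prod_grp[OF has_mults_binV has_mults_binD4] inv_dims_prod_grp[OF has_mults_binV has_mults_binD6]
      inv_dims_prod_grp[OF has_mults_binV has_mults_binD8] inv_dims_prod_grp[OF has_mults_binT has_mults_binD4]
      inv_dims_prod_grp[OF has_mults_binT has_mults_binD6] inv_dims_prod_grp[OF has_mults_binT has_mults_binD8]
      inv_dims_prod_grp[OF has_mults_binO has_mults_binD4] inv_dims_prod_grp[OF has_mults_binO has_mults_binD6]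
      inv_dims_prod_grp[OF has_mults_binO has_mults_binD8] inv_dims_prod_grp[OF has_mults_binI has_mults_binD4]
      inv_dims_prod_grp[OF has_mults_binI has_mults_binD6] inv_dims_prod_grp[OF has_mults_binI has_mults_binD8]
      inv_dims_binT_binV inv_dims_binO_binT inv_dims_binO_binV partial_sums_Cons)

end
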